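(* Let $R=\{\alpha_1,\dots,\alpha_d\}$ be a family of not necessarily distinct elements of $\Lambda^*$ lying in an open half-space of $\mathfrak t^*$ and generating the vector space $\mathfrak t^*$. Let $\mathfrak c_+,\mathfrak c_-$ be two adjacent conic chambers separated by the hyperplane $\Delta=\{\xi:\langle\xi,\beta\rangle=0\}$, with $\mathfrak c_\pm\subset\{\xi:\pm\langle\xi,\beta\rangle>0\}$, and let $\mathfrak c'$ be the relative interior of $\overline{\mathfrak c_+}\cap\overline{\mathfrak c_-}$ in $\Delta$. Then the periodic polynomial $P_{\mathfrak c_+}-P_{\mathfrak c_-}:\Lambda^*\to\mathbb Z$ satisfies $$P_{\mathfrak c_+}(\mu)-P_{\mathfrak c_-}(\mu)=\sum_{\gamma\in\Lambda^*\cap\Delta}D(\mu-\gamma)\,P_{\mathfrak c'}(\gamma),\qquad\mu\in\Lambda^*,$$ where $D:\Lambda^*\to\mathbb Z$ is defined by $$D(\mu)=(-1)^{r^-}N_{R'}(\mu+\delta^-)-(-1)^{r^+}N_{R'}(-\mu-\delta^+).$$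
   Context: $T$ is a torus with Lie algebra $\mathfrak t$ and weight lattice $\Lambda^*\subset\mathfrak t^*$. For a finite family $R=\{\alpha_1,\dots,\alpha_d\}$ of weights in an open half-space, $N_R(\mu)$ is the number of solutions of $\sum_jk_j\alpha_j=\mu$ with $k_j\in\mathbb Z_{\ge0}$ (vector partition function), and $C(R)$ is the closed convex cone generated by $R$. For $R$ generating $\mathfrak t^*$, a vector is singular if it lies in a cone $C(\nu)$ with $\nu\subset R$ of cardinality $<\dim T$; conic chambers are the connected components of the complement in $\mathfrak t^*$ of the set of singular vectors. A periodic polynomial on a lattice $\Xi$ is a finite sum $\sum_je^{i\langle a_j,x\rangle/N}P_j(x)$ with $a_j\in\mathrm{Hom}(\Xi,2\pi\mathbb Z)$, $N\ge1$, $P_j$ polynomials. For a conic chamber $\mathfrak c\subset C(R)$, $P_{\mathfrak c}$ is the unique periodic polynomial on $\Lambda^*$ with $N_R(\mu)=P_{\mathfrak c}(\mu)$ for $\mu\in\overline{\mathfrak c}\cap\Lambda^*$; $P_{\mathfrak c}=0$ if $\mathfrak c\cap C(R)=\emptyset$. Adjacent chambers: distinct, with $\overline{\mathfrak c_+}\cap\overline{\mathfrak c_-}$ contained in a hyperplane $\Delta$ and having nonempty relative interior $\mathfrak c'$ in $\Delta$. Then $R\cap\Delta$ (the subfamily of those $\alpha_j$ in $\Delta$) generates $\Delta$, $\mathfrak c'$ is a conic chamber of $\Delta$ with respect to $R\cap\Delta$, and $P_{\mathfrak c'}$ is the periodic polynomial on $\Lambda^*\cap\Delta$ coinciding with $N_{R\cap\Delta}$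 on $\overline{\mathfrak c'}\cap\Lambda^*$ (if $\dim T=1$, $\Delta=\{0\}$ and $P_{\mathfrak c'}(0)=1$). $R'=\{\epsilon_j\alpha_j:\langle\alpha_j,\beta\rangle\ne0\}$ with $\epsilon_j=\mathrm{sign}\langle\alpha_j,\beta\rangle$ (as a family, with multiplicity); $\delta^\pm=\sum_{\pm\langle\alpha_j,\beta\rangle>0}\alpha_j$; $r^\pm=\#\{j:\pm\langle\alpha_j,\beta\rangle>0\}$. *)

theory Defs
  imports "HOL-Analysis.Analysis"
begin

text \<open>
  The Euclidean space \<open>'a\<close> plays the role of the dual \<open>\<tt>\<^sup>*\<close> of the Lie algebra of the torus; the
  pairing with an element \<open>\<beta>\<close> of the Lie algebra itself is written as the inner product \<open>\<xi> \<bullet> \<beta>\<close>.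
  A family of vectors, possibly with repetitions, is a function \<open>\<alpha>\<close> together with a finite set
  \<open>J\<close> of indices, and its subfamilies are given by subsets of \<open>J\<close>.
\<close>

definition full_lattice :: "'a::euclidean_space set \<Rightarrow> bool" where
  "full_lattice L \<longleftrightarrow>
     (\<exists>B. independent B \<and> span B = UNIV \<and> L = {\<Sum>b\<in>B. of_int (z b) *\<^sub>R b | z :: 'a \<Rightarrow> int. True})"

definition vector_partition :: "'i set \<Rightarrow> ('i \<Rightarrow> 'a::real_vector) \<Rightarrow> 'a \<Rightarrow> nat" where
  "vector_partition J \<alpha> \<mu> =
     card {k \<in> J \<rightarrow>\<^sub>E (UNIV :: nat set). (\<Sum>j\<in>J. of_nat (k j) *\<^sub>R \<alpha> j) = \<mu>}"

text \<open>For a finite family the generated convex cone is automatically closed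
  (see \<open>polyhedron_convex_cone_hull\<close>).\<close>

definition family_cone :: "'i set \<Rightarrow> ('i \<Rightarrow> 'a::real_vector) \<Rightarrow> 'a set" where
  "family_cone J \<alpha> = convex_cone hull (\<alpha> ` J)"

definition singular_vectors :: "'i set \<Rightarrow> ('i \<Rightarrow> 'a::euclidean_space) \<Rightarrow> 'a set" where
  "singular_vectors J \<alpha> = (\<Union>\<nu> \<in> {\<nu>. \<nu> \<subseteq> J \<and> card \<nu> < DIM('a)}. family_cone \<nu> \<alpha>)"

definition conic_chambers :: "'i set \<Rightarrow> ('i \<Rightarrow> 'a::euclidean_space) \<Rightarrow> 'a set set" where
  "conic_chambers J \<alpha> = components (- singular_vectors J \<alpha>)"

definition hyperplane :: "'a::euclidean_space \<Rightarrow> 'a set" where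
  "hyperplane \<beta> = {\<xi>. \<xi> \<bullet> \<beta> = 0}"

definition wall :: "'a::euclidean_space \<Rightarrow> 'a set \<Rightarrow> 'a set \<Rightarrow> 'a set" where
  "wall \<beta> c\<^sub>1 c\<^sub>2 = top_of_set (hyperplane \<beta>) interior_of (closure c\<^sub>1 \<inter> closure c\<^sub>2)"

definition adjacent_chambers ::
  "'i set \<Rightarrow> ('i \<Rightarrow> 'a::euclidean_space) \<Rightarrow> 'a \<Rightarrow> 'a set \<Rightarrow> 'a set \<Rightarrow> bool" where
  "adjacent_chambers J \<alpha> \<beta> c\<^sub>1 c\<^sub>2 \<longleftrightarrow>
     c\<^sub>1 \<in> conic_chambers J \<alpha> \<and> c\<^sub>2 \<in> conic_chambers J \<alpha> \<and> c\<^sub>1 \<noteq> c\<^sub>2 \<and>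
     closure c\<^sub>1 \<inter> closure c\<^sub>2 \<subseteq> hyperplane \<beta> \<and> wall \<beta> c\<^sub>1 c\<^sub>2 \<noteq> {}"

text \<open>Only the values of \<open>f\<close> on the subgroup \<open>\<Xi>\<close> matter. When \<open>\<Xi>\<close> spans a proper subspace,
  the polynomials on that subspace are exactly the restrictions of those on \<open>'a\<close>.\<close>

definition periodic_polynomial_on :: "'a::euclidean_space set \<Rightarrow> ('a \<Rightarrow> complex) \<Rightarrow> bool" where
  "periodic_polynomial_on \<Xi> f \<longleftrightarrow>
     (\<exists>(N::nat) (m::nat) (a :: nat \<Rightarrow> 'a \<Rightarrow> real) (p :: nat \<Rightarrow> 'a \<Rightarrow> complex).
        N \<ge> 1 \<and>
        (\<forall>j<m. (\<forall>x\<in>\<Xi>. \<exists>n::int. a j x = 2 * pi * of_int n) \<and>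
               (\<forall>x\<in>\<Xi>. \<forall>y\<in>\<Xi>. a j (x + y) = a j x + a j y) \<and>
               polynomial_function (p j)) \<and>
        (\<forall>x\<in>\<Xi>. f x = (\<Sum>j<m. exp (\<i> * complex_of_real (a j x / real N)) * p j x)))"

definition partition_quasipolynomial ::
  "'a::euclidean_space set \<Rightarrow> 'i set \<Rightarrow> ('i \<Rightarrow> 'a) \<Rightarrow> 'a set \<Rightarrow> ('a \<Rightarrow> complex) \<Rightarrow> bool" where
  "partition_quasipolynomial \<Xi> J \<alpha> c P \<longleftrightarrow>
     periodic_polynomial_on \<Xi> P \<and>
     (\<forall>\<mu> \<in> closure c \<inter> \<Xi>. P \<mu> = of_nat (vector_partition J \<alpha> \<mu>))"

text \<open>A chamber is either contained in the cone of the family or disjoint from it.\<close>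

definition chamber_quasipolynomial ::
  "'a::euclidean_space set \<Rightarrow> 'i set \<Rightarrow> ('i \<Rightarrow> 'a) \<Rightarrow> 'a set \<Rightarrow> ('a \<Rightarrow> complex) \<Rightarrow> bool" where
  "chamber_quasipolynomial L J \<alpha> c P \<longleftrightarrow>
     (c \<subseteq> family_cone J \<alpha> \<longrightarrow> partition_quasipolynomial L J \<alpha> c P) \<and>
     (c \<inter> family_cone J \<alpha> = {} \<longrightarrow> (\<forall>\<mu>\<in>L. P \<mu> = 0))"

definition wall_crossing_kernel ::
  "'i set \<Rightarrow> ('i \<Rightarrow> 'a::euclidean_space) \<Rightarrow> 'a \<Rightarrow> 'a \<Rightarrow> int" where
  "wall_crossing_kernel J \<alpha> \<beta> \<mu> =
     (let J\<^sub>p = {j\<in>J. \<alpha> j \<bullet> \<beta> > 0};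
          J\<^sub>m = {j\<in>J. \<alpha> j \<bullet> \<beta> < 0};
          N' = vector_partition {j\<in>J. \<alpha> j \<bullet> \<beta> \<noteq> 0} (\<lambda>j. sgn (\<alpha> j \<bullet> \<beta>) *\<^sub>R \<alpha> j)
      in (-1) ^ card J\<^sub>m * int (N' (\<mu> + (\<Sum>j\<in>J\<^sub>m. \<alpha> j)))
         - (-1) ^ card J\<^sub>p * int (N' (- \<mu> - (\<Sum>j\<in>J\<^sub>p. \<alpha> j))))"

end

theory Submission
  imports Defs "HOL-Computational_Algebra.Polynomial"
begin

text \<open>
  Replace every \<open>\<alpha>\<^sub>j\<close> off \<open>\<Delta>\<close> by \<open>\<plusminus>\<alpha>\<^sub>j\<close> so that it points to the positive side, and let \<open>T\<close> be the product
  of the corresponding backward difference operators. Up to sign and translation by \<open>\<delta>\<^sup>-\<close>, \<open>T\<close> turns \<open>N\<^sub>R\<close> into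
  \<open>N\<^bsub>R \<inter> \<Delta>\<^esub>\<close>, supported on \<open>\<Delta>\<close>, and turns each of the two halves of \<open>D\<close> into the same delta function.
  Hence \<open>T\<close> annihilates both quasi-polynomials and the right-hand side. Near a generic rational ray
  \<open>v\<close> of the wall, \<open>N\<^sub>R - P\<^sub>-\<close> minus the convolution of the first half of \<open>D\<close> with the wall
  quasi-polynomial vanishes on the negative side and is annihilated by \<open>T\<close>, so it vanishes on the
  positive side as well, where it is the difference of the two sides of the formula. That difference is
  polynomial along arithmetic progressions in the direction \<open>v\<close>, so it vanishes on the whole positive
  half-space, and the recursion \<open>T = 0\<close> carries this over to all of the lattice.
\<close>

section \<open>Partition functions and difference operators\<close>

text \<open>All summands are nonnegative, so each \<open>k j\<close> is at most
  \<open>C / w j\<close>. The bound serves both counting (weights from the half-space vector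
  \<open>h\<close>) and the supports of convolutions (weights from \<beta>).\<close>

lemma finite_bounded_multiplicities:
  fixes w :: "'i \<Rightarrow> real"
  assumes "finite J" and pos: "\<And>j. j \<in> J \<Longrightarrow> w j > 0"
  shows "finite {k \<in> J \<rightarrow>\<^sub>E (UNIV :: nat set). (\<Sum>j\<in>J. real (k j) * w j) \<le> C}"
proof (rule finite_subset)
  show "{k \<in> J \<rightarrow>\<^sub>E (UNIV :: nat set). (\<Sum>j\<in>J. real (k j) * w j) \<le> C}
      \<subseteq> (\<Pi>\<^sub>E j\<in>J. {..nat \<lceil>C / w j\<rceil>})"
  proof
    fix k assume k: "k \<in> {k \<in> J \<rightarrow>\<^sub>E (UNIV :: nat set). (\<Sum>j\<in>J. real (k j) * w j) \<le> C}"
    have "k j \<le> nat \<lceil>C / w j\<rceil>" if j: "j \<in> J" for j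
    proof -
      have "real (k j) * w j \<le> (\<Sum>j\<in>J. real (k j) * w j)"
        by (rule member_le_sum[OF j]) (use assms(1) in \<open>auto intro: mult_nonneg_nonneg less_imp_le[OF pos]\<close>)
      with k have "real (k j) * w j \<le> C" by simp
      with pos[OF j] have "real (k j) \<le> C / w j" by (simp add: pos_le_divide_eq)
      then show ?thesis by linarith
    qed
    with k show "k \<in> (\<Pi>\<^sub>E j\<in>J. {..nat \<lceil>C / w j\<rceil>})" by (auto simp: PiE_iff)
  qed
qed (use assms in \<open>auto intro: finite_PiE\<close>)

lemma finite_vector_partitions:
  fixes \<alpha> :: "'i \<Rightarrow> 'a::euclidean_space"
  assumes "finite J" "\<And>j. j \<in> J \<Longrightarrow> \<alpha> j \<bullet> h > 0"
  shows "finite {k \<in> J \<rightarrow>\<^sub>E (UNIV :: nat set). (\<Sum>j\<in>J. of_nat (k j) *\<^sub>R \<alpha> j) = \<mu>}"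
  by (rule finite_subset[OF _ finite_bounded_multiplicities[OF assms(1), of "\<lambda>j. \<alpha> j \<bullet> h" "\<mu> \<bullet> h"]])
     (use assms(2) in \<open>auto simp: inner_sum_left\<close>)

lemma vector_partition_empty: "vector_partition {} \<alpha> \<mu> = (if \<mu> = 0 then 1 else 0)"
  by (auto simp: vector_partition_def)

lemma vector_partition_nonzeroE:
  assumes "vector_partition J \<alpha> \<mu> \<noteq> 0"
  obtains k :: "'i \<Rightarrow> nat" where "k \<in> J \<rightarrow>\<^sub>E UNIV" "\<mu> = (\<Sum>j\<in>J. of_nat (k j) *\<^sub>R \<alpha> j)"
proof -
  let ?X = "{k \<in> J \<rightarrow>\<^sub>E (UNIV :: nat set). (\<Sum>j\<in>J. of_nat (k j) *\<^sub>R \<alpha> j) = \<mu>}"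
  have "card ?X \<noteq> 0" using assms unfolding vector_partition_def .
  then have "?X \<noteq> {}" by (rule contrapos_nn) (simp only: card.empty)
  then obtain k where "k \<in> ?X" by (meson ex_in_conv)
  then show ?thesis using that[of k] by simp
qed

text \<open>Solutions with \<open>k j = 0\<close> are solutions over \<open>J\<close>; the others
  correspond, by lowering \<open>k j\<close> by one, to solutions for
  \<open>\<mu> - \<alpha> j\<close>. Positivity on \<open>h\<close> keeps these sets finite, so that
  their cardinalities add up.\<close>

lemma vector_partition_insert:
  fixes \<alpha> :: "'i \<Rightarrow> 'a::euclidean_space"
  assumes J: "finite J" "j \<notin> J" and pos: "\<And>i. i \<in> insert j J \<Longrightarrow> \<alpha> i \<bullet> h > 0"
  shows "vector_partition (insert j J) \<alpha> \<mu> =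
    vector_partition J \<alpha> \<mu> + vector_partition (insert j J) \<alpha> (\<mu> - \<alpha> j)"
proof -
  define X where
    "X K \<mu> = {k \<in> K \<rightarrow>\<^sub>E (UNIV :: nat set). (\<Sum>i\<in>K. of_nat (k i) *\<^sub>R \<alpha> i) = \<mu>}" for K \<mu>
  have X_insert: "k \<in> X (insert j J) \<nu> \<longleftrightarrow>
      k \<in> insert j J \<rightarrow>\<^sub>E UNIV \<and> of_nat (k j) *\<^sub>R \<alpha> j + (\<Sum>i\<in>J. of_nat (k i) *\<^sub>R \<alpha> i) = \<nu>" for k \<nu>
    using J by (auto simp: X_def)
  have upd: "(\<Sum>i\<in>J. of_nat ((k(j := n)) i) *\<^sub>R \<alpha> i) = (\<Sum>i\<in>J. of_nat (k i) *\<^sub>R \<alpha> i)"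
    for k :: "'i \<Rightarrow> nat" and n
    by (rule sum.cong) (use J in auto)
  have mem: "k(j := n) \<in> X (insert j J) \<nu>"
    if "k \<in> insert j J \<rightarrow>\<^sub>E UNIV" "of_nat n *\<^sub>R \<alpha> j + (\<Sum>i\<in>J. of_nat (k i) *\<^sub>R \<alpha> i) = \<nu>" for k n \<nu>
    unfolding X_insert upd using that by (auto simp: PiE_iff extensional_def)
  have fin: "finite (X (insert j J) \<nu>)" for \<nu>
    unfolding X_def by (rule finite_vector_partitions[where h = h]) (use J pos in auto)
  have "X (insert j J) \<mu> = {k \<in> X (insert j J) \<mu>. k j = 0} \<union> {k \<in> X (insert j J) \<mu>. k j \<noteq> 0}"
    by auto
  then have "card (X (insert j J) \<mu>)
      = card {k \<in> X (insert j J) \<mu>. k j = 0} + card {k \<in> X (insert j J) \<mu>. k j \<noteq> 0}"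
    using fin by (subst card_Un_disjoint[symmetric]) auto
  \<comment> \<open>Functions in \<open>PiE\<close> are \<open>undefined\<close> off their domain,
    so dropping the index \<open>j\<close> resets the value 0 there to
    \<open>undefined\<close>.\<close>
  also have "card {k \<in> X (insert j J) \<mu>. k j = 0} = card (X J \<mu>)"
  proof (rule bij_betw_same_card[OF bij_betwI[of "\<lambda>k. k(j := undefined)" _ _ "\<lambda>k. k(j := 0)"]])
    show "(\<lambda>k. k(j := undefined)) \<in> {k \<in> X (insert j J) \<mu>. k j = 0} \<rightarrow> X J \<mu>"
    proof
      fix k assume "k \<in> {k \<in> X (insert j J) \<mu>. k j = 0}"
      then show "k(j := undefined) \<in> X J \<mu>"
        using J unfolding X_insert mem_Collect_eq by (auto simp add: X_def upd PiE_iff extensional_def simp del: fun_upd_apply)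
          (simp add: fun_upd_apply)
    qed
    show "(\<lambda>k. k(j := 0)) \<in> X J \<mu> \<rightarrow> {k \<in> X (insert j J) \<mu>. k j = 0}"
    proof
      fix k assume "k \<in> X J \<mu>"
      then have "k(j := 0) \<in> X (insert j J) \<mu>"
        using J unfolding X_insert upd by (auto simp: X_def PiE_iff extensional_def)
      then show "k(j := 0) \<in> {k \<in> X (insert j J) \<mu>. k j = 0}" by simp
    qed
  qed (use J in \<open>auto simp: X_def PiE_iff extensional_def fun_eq_iff\<close>)
  \<comment> \<open>The truncated subtraction \<open>k j - 1\<close> is exact because
    \<open>k j \<noteq> 0\<close>.\<close>
  also have "card {k \<in> X (insert j J) \<mu>. k j \<noteq> 0} = card (X (insert j J) (\<mu> - \<alpha> j))"
  proof (rule bij_betw_same_card[OF bij_betwI[of "\<lambda>k. k(j := k j - 1)" _ _ "\<lambda>k. k(j := k j + 1)"]])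
    show "(\<lambda>k. k(j := k j - 1)) \<in> {k \<in> X (insert j J) \<mu>. k j \<noteq> 0} \<rightarrow> X (insert j J) (\<mu> - \<alpha> j)"
    proof
      fix k assume "k \<in> {k \<in> X (insert j J) \<mu>. k j \<noteq> 0}"
      then show "k(j := k j - 1) \<in> X (insert j J) (\<mu> - \<alpha> j)"
        by (intro mem) (auto simp: X_insert of_nat_diff scaleR_left_diff_distrib)
    qed
    show "(\<lambda>k. k(j := k j + 1)) \<in> X (insert j J) (\<mu> - \<alpha> j) \<rightarrow> {k \<in> X (insert j J) \<mu>. k j \<noteq> 0}"
    proof
      fix k assume k: "k \<in> X (insert j J) (\<mu> - \<alpha> j)"
      have "k(j := k j + 1) \<in> X (insert j J) \<mu>"
      proof (rule mem)
        show "k \<in> insert j J \<rightarrow>\<^sub>E UNIV" using k by (simp add: X_insert)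
        have "of_nat (k j) *\<^sub>R \<alpha> j + (\<Sum>i\<in>J. of_nat (k i) *\<^sub>R \<alpha> i) = \<mu> - \<alpha> j"
          using k by (simp add: X_insert)
        then have "(of_nat (k j) *\<^sub>R \<alpha> j + (\<Sum>i\<in>J. of_nat (k i) *\<^sub>R \<alpha> i)) + \<alpha> j = \<mu>" by simp
        then show "of_nat (k j + 1) *\<^sub>R \<alpha> j + (\<Sum>i\<in>J. of_nat (k i) *\<^sub>R \<alpha> i) = \<mu>"
          by (simp add: scaleR_left_distrib ac_simps)
      qed
      then show "k(j := k j + 1) \<in> {k \<in> X (insert j J) \<mu>. k j \<noteq> 0}" by simp
    qed
  qed (auto simp: X_def)
  finally show ?thesis by (simp add: vector_partition_def X_def)
qed

text \<open>The product over \<open>j \<in> S\<close> of the backward differences \<open>f \<mapsto> f - f (\<cdot> - a j)\<close>, expanded.\<close>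

definition diffop :: "'i set \<Rightarrow> ('i \<Rightarrow> 'a::real_vector) \<Rightarrow> ('a \<Rightarrow> complex) \<Rightarrow> 'a \<Rightarrow> complex" where
  "diffop S a f \<mu> = (\<Sum>I\<in>Pow S. (-1) ^ card I * f (\<mu> - sum a I))"

section \<open>Calculus of the difference operators\<close>

lemma diffop_insert:
  assumes "finite S" "j \<notin> S"
  shows "diffop (insert j S) a f \<mu> = diffop S a f \<mu> - diffop S a f (\<mu> - a j)"
proof -
  have "diffop (insert j S) a f \<mu> = diffop S a f \<mu> +
      (\<Sum>I\<in>insert j ` Pow S. (-1) ^ card I * f (\<mu> - sum a I))"
    unfolding diffop_def Pow_insert by (rule sum.union_disjoint) (use assms in auto)
  also have "(\<Sum>I\<in>insert j ` Pow S. (-1) ^ card I * f (\<mu> - sum a I))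
      = (\<Sum>I\<in>Pow S. (-1) ^ card (insert j I) * f (\<mu> - sum a (insert j I)))"
    by (subst sum.reindex) (use assms in \<open>auto simp: inj_on_def\<close>)
  also have "\<dots> = - diffop S a f (\<mu> - a j)"
    unfolding diffop_def sum_negf[symmetric]
  proof (rule sum.cong)
    fix I assume "I \<in> Pow S"
    then have "finite I" "j \<notin> I" using assms by (auto intro: finite_subset)
    then show "(-1) ^ card (insert j I) * f (\<mu> - sum a (insert j I))
        = - ((-1) ^ card I * f (\<mu> - a j - sum a I))"
      by (simp add: algebra_simps)
  qed simp
  finally show ?thesis by simp
qed

lemma diffop_diff: "diffop S a (\<lambda>x. f x - g x) \<mu> = diffop S a f \<mu> - diffop S a g \<mu>"
  by (simp add: diffop_def algebra_simps sum_subtractf)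

lemma diffop_cmult: "diffop S a (\<lambda>x. c * f x) \<mu> = c * diffop S a f \<mu>"
  by (simp add: diffop_def algebra_simps sum_distrib_left)

lemma diffop_translate: "diffop S a (\<lambda>x. f (x + c)) \<mu> = diffop S a f (\<mu> + c)"
  by (simp add: diffop_def algebra_simps)

text \<open>Agreement is demanded only at the points that the operator reads, which later allows
  agreement that holds merely deep inside a chamber.\<close>

lemma diffop_cong:
  assumes "\<And>j. j \<in> S \<Longrightarrow> a j = b j" "\<And>I. I \<subseteq> S \<Longrightarrow> f (\<mu> - sum b I) = g (\<mu> - sum b I)"
  shows "diffop S a f \<mu> = diffop S b g \<mu>"
  unfolding diffop_def
proof (rule sum.cong)
  fix I assume "I \<in> Pow S"
  then have "sum a I = sum b I" using assms(1) by (intro sum.cong) auto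
  with assms(2) \<open>I \<in> Pow S\<close> show "(-1) ^ card I * f (\<mu> - sum a I) = (-1) ^ card I * g (\<mu> - sum b I)"
    by simp
qed simp

text \<open>The empty subset contributes the value at \<mu> itself; isolating it turns an equation
  for the operator into a recursion from points shifted by nonempty sums.\<close>

lemma diffop_first_term:
  assumes "finite S"
  shows "diffop S a f \<mu> = f \<mu> + (\<Sum>I\<in>Pow S - {{}}. (-1) ^ card I * f (\<mu> - sum a I))"
  unfolding diffop_def by (subst sum.remove[of _ "{}"]) (use assms in auto)

text \<open>In generating functions each difference multiplies by 1 - e^(\<alpha>_j) and so cancels
  the geometric series of one generator; a single such cancellation is
  \<open>vector_partition_insert\<close>.\<close>

lemma diffop_vector_partition:
  fixes \<alpha> :: "'i \<Rightarrow> 'a::euclidean_space"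
  assumes "finite S" "finite K" "S \<inter> K = {}" "\<And>i. i \<in> S \<union> K \<Longrightarrow> \<alpha> i \<bullet> h > 0"
  shows "diffop S \<alpha> (\<lambda>x. of_nat (vector_partition (S \<union> K) \<alpha> x)) \<mu> = of_nat (vector_partition K \<alpha> \<mu>)"
  using assms
proof (induction S arbitrary: \<mu> rule: finite_induct)
  case empty
  then show ?case by (simp add: diffop_def)
next
  case (insert j S)
  define g :: "'a \<Rightarrow> complex" where "g x = of_nat (vector_partition (insert j (S \<union> K)) \<alpha> x)" for x
  have step: "g x - g (x + - \<alpha> j) = of_nat (vector_partition (S \<union> K) \<alpha> x)" for x
    using vector_partition_insert[of "S \<union> K" j \<alpha> h x] insert by (auto simp: g_def)
  have "diffop (insert j S) \<alpha> (\<lambda>x. of_nat (vector_partition (insert j S \<union> K) \<alpha> x)) \<mu>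
     = diffop S \<alpha> g \<mu> - diffop S \<alpha> g (\<mu> + - \<alpha> j)"
    using diffop_insert[OF insert.hyps(1,2), of \<alpha> g \<mu>] by (simp add: g_def[abs_def])
  also have "\<dots> = diffop S \<alpha> (\<lambda>x. g x - g (x + - \<alpha> j)) \<mu>"
    by (simp only: diffop_diff diffop_translate)
  also have "\<dots> = diffop S \<alpha> (\<lambda>x. of_nat (vector_partition (S \<union> K) \<alpha> x)) \<mu>"
    by (simp only: step)
  also have "\<dots> = of_nat (vector_partition K \<alpha> \<mu>)"
    using insert by auto
  finally show ?case .
qed

text \<open>For one reversed direction, f(x) - f(x + a) is minus the backward difference at x + a;
  each reversal thus costs a sign and a translation.\<close>

lemma diffop_flip:
  assumes "finite S"
  shows "diffop S (\<lambda>j. if j \<in> M then - a j else a j) f \<mu>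
    = (-1) ^ card (S \<inter> M) * diffop S a f (\<mu> + sum a (S \<inter> M))"
  using assms
proof (induction S arbitrary: \<mu> rule: finite_induct)
  case empty
  then show ?case by (simp add: diffop_def)
next
  case (insert j S)
  then show ?case by (cases "j \<in> M") (simp_all add: diffop_insert Int_insert_left algebra_simps)
qed

text \<open>Reflecting the argument reverses every direction, which is \<open>diffop_flip\<close>
  with all of \<open>S\<close> flipped.\<close>

lemma diffop_reflect:
  assumes "finite S"
  shows "diffop S a (\<lambda>x. f (c - x)) \<mu> = (-1) ^ card S * diffop S a f (c - \<mu> + sum a S)"
proof -
  have "diffop S a (\<lambda>x. f (c - x)) \<mu> = diffop S (\<lambda>j. - a j) f (c - \<mu>)"
    by (simp add: diffop_def sum_negf algebra_simps)
  also have "\<dots> = diffop S (\<lambda>j. if j \<in> S then - a j else a j) f (c - \<mu>)"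
    by (rule diffop_cong) auto
  also have "\<dots> = (-1) ^ card S * diffop S a f (c - \<mu> + sum a S)"
    using diffop_flip[OF assms, of S] by simp
  finally show ?thesis .
qed

lemma infsum_finite_support:
  fixes f :: "'b \<Rightarrow> complex"
  assumes "finite F" "F \<subseteq> \<Gamma>" "\<And>\<gamma>. \<gamma> \<in> \<Gamma> - F \<Longrightarrow> f \<gamma> = 0"
  shows "infsum f \<Gamma> = sum f F"
  by (rule infsumI[OF has_sum_finite_neutralI[OF assms]]) auto

text \<open>The operator reads finitely many shifts, so one finite set \<open>F\<close> supports all
  the sums involved and the two summations may be exchanged.\<close>

lemma diffop_infsum_convolution:
  fixes f p :: "'a::real_vector \<Rightarrow> complex"
  assumes S: "finite S" and fin: "\<And>x. finite {\<gamma>\<in>\<Gamma>. f (x - \<gamma>) \<noteq> 0}"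
  shows "diffop S a (\<lambda>x. \<Sum>\<^sub>\<infinity>\<gamma>\<in>\<Gamma>. f (x - \<gamma>) * p \<gamma>) \<mu> = (\<Sum>\<^sub>\<infinity>\<gamma>\<in>\<Gamma>. diffop S a f (\<mu> - \<gamma>) * p \<gamma>)"
proof -
  define F where "F = (\<Union>I\<in>Pow S. {\<gamma>\<in>\<Gamma>. f (\<mu> - sum a I - \<gamma>) \<noteq> 0})"
  have F: "finite F" "F \<subseteq> \<Gamma>" using S fin by (auto simp: F_def)
  have zero: "f (\<mu> - sum a I - \<gamma>) = 0" if "\<gamma> \<in> \<Gamma> - F" "I \<in> Pow S" for I \<gamma>
    using that by (auto simp: F_def)
  have "diffop S a (\<lambda>x. \<Sum>\<^sub>\<infinity>\<gamma>\<in>\<Gamma>. f (x - \<gamma>) * p \<gamma>) \<mu>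
      = (\<Sum>I\<in>Pow S. (-1) ^ card I * (\<Sum>\<gamma>\<in>F. f (\<mu> - sum a I - \<gamma>) * p \<gamma>))"
    unfolding diffop_def
    by (intro sum.cong refl arg_cong2[where f = "(*)"] infsum_finite_support F) (simp add: zero)
  also have "\<dots> = (\<Sum>\<gamma>\<in>F. diffop S a f (\<mu> - \<gamma>) * p \<gamma>)"
    unfolding diffop_def sum_distrib_left sum_distrib_right
    by (subst sum.swap) (simp add: algebra_simps)
  also have "\<dots> = (\<Sum>\<^sub>\<infinity>\<gamma>\<in>\<Gamma>. diffop S a f (\<mu> - \<gamma>) * p \<gamma>)"
  proof (rule infsum_finite_support[symmetric, OF F])
    fix \<gamma> assume "\<gamma> \<in> \<Gamma> - F"
    then have "diffop S a f (\<mu> - \<gamma>) = 0"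
      unfolding diffop_def
      by (intro sum.neutral ballI) (use zero in \<open>simp add: algebra_simps\<close>)
    then show "diffop S a f (\<mu> - \<gamma>) * p \<gamma> = 0" by simp
  qed
  finally show ?thesis .
qed

section \<open>Quasi-polynomials along lines\<close>

text \<open>Only the multiples of one \<open>N\<close> matter: there the exponential factors of a
  periodic polynomial are constant, and the conclusions drawn concern the value at 0, which lies on
  every such progression.\<close>

definition poly_on_progression :: "(nat \<Rightarrow> complex) \<Rightarrow> bool" where
  "poly_on_progression h \<longleftrightarrow>
     (\<exists>N\<ge>1. \<exists>q :: complex poly. \<forall>n. h (n * N) = poly q (of_nat n))"

lemma poly_on_progression_add:
  assumes "poly_on_progression h" "poly_on_progression g"
  shows "poly_on_progression (\<lambda>n. h n + g n)"
proof -
  from assms obtain N M p q where N: "N \<ge> 1" "\<And>n. h (n * N) = poly p (of_nat n)"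
    and M: "M \<ge> 1" "\<And>n. g (n * M) = poly q (of_nat n)"
    unfolding poly_on_progression_def by blast
  \<comment> \<open>\<open>N * M\<close> is a common period; composing with
    \<open>[:0, of_nat M:]\<close> substitutes \<open>n * M\<close> for \<open>n\<close>.\<close>
  have "h (n * (N * M)) + g (n * (N * M)) = poly (p \<circ>\<^sub>p [:0, of_nat M:] + q \<circ>\<^sub>p [:0, of_nat N:]) (of_nat n)" for n
    using N(2)[of "n * M"] M(2)[of "n * N"] by (simp add: poly_pcompose algebra_simps)
  moreover have "N * M \<ge> 1" using N M by simp
  ultimately show ?thesis unfolding poly_on_progression_def by blast
qed

lemma poly_on_progression_cmult:
  assumes "poly_on_progression h"
  shows "poly_on_progression (\<lambda>n. c * h n)"
proof -
  from assms obtain N p where N: "N \<ge> 1" "\<And>n. h (n * N) = poly p (of_nat n)"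
    unfolding poly_on_progression_def by blast
  then have "\<And>n. c * h (n * N) = poly (smult c p) (of_nat n)" by simp
  with N(1) show ?thesis unfolding poly_on_progression_def by blast
qed

lemma poly_on_progression_diff:
  assumes "poly_on_progression h" "poly_on_progression g"
  shows "poly_on_progression (\<lambda>n. h n - g n)"
  using poly_on_progression_add[OF assms(1) poly_on_progression_cmult[OF assms(2), of "-1"]] by simp

lemma poly_on_progression_zero: "poly_on_progression (\<lambda>n. 0)"
  unfolding poly_on_progression_def by (intro exI[of _ 1] conjI exI[of _ 0]) auto

lemma poly_on_progression_sum:
  assumes "finite A" "\<And>i. i \<in> A \<Longrightarrow> poly_on_progression (h i)"
  shows "poly_on_progression (\<lambda>n. \<Sum>i\<in>A. h i n)"
  using assms
  by (induction A rule: finite_induct) (auto intro: poly_on_progression_zero poly_on_progression_add)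

lemma eventually_progression:
  assumes "N \<ge> (1::nat)" "\<forall>\<^sub>F n in sequentially. P n"
  shows "\<forall>\<^sub>F n in sequentially. P (n * N)"
proof -
  from assms(2) obtain m where m: "\<And>n. n \<ge> m \<Longrightarrow> P n" by (auto simp: eventually_sequentially)
  have "P (n * N)" if "n \<ge> m" for n
  proof (rule m)
    have "n * 1 \<le> n * N" using assms(1) by (intro mult_le_mono) auto
    then show "m \<le> n * N" using that by linarith
  qed
  then show ?thesis by (auto simp: eventually_sequentially)
qed

text \<open>The polynomial describing the progression has infinitely many zeros, hence is zero, also
  at 0.\<close>

lemma poly_on_progression_eventually_zero:
  assumes "poly_on_progression h" "\<forall>\<^sub>F n in sequentially. h n = 0"
  shows "h 0 = 0"
proof -
  from assms(1) obtain N p where N: "N \<ge> 1" "\<And>n. h (n * N) = poly p (of_nat n)"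
    unfolding poly_on_progression_def by blast
  from eventually_progression[OF N(1) assms(2)] obtain m where "\<And>n. n \<ge> m \<Longrightarrow> poly p (of_nat n) = 0"
    by (auto simp: eventually_sequentially N(2))
  then have "of_nat ` {m..} \<subseteq> {x. poly p x = 0}" by auto
  moreover have "infinite (of_nat ` {m..} :: complex set)"
    by (subst finite_image_iff) (auto simp: inj_on_def infinite_Ici)
  ultimately have "p = 0" using poly_roots_finite finite_subset by blast
  with N(2)[of 0] show ?thesis by simp
qed

text \<open>Induction on the degree: the forward difference has smaller degree and is integral from
  \<open>m\<close> on, hence at all naturals; integrality of \<open>q\<close> then descends from
  \<open>m\<close> one step at a time.\<close>

lemma poly_integral_on_nat:
  fixes q :: "complex poly"
  assumes "\<And>n. n \<ge> m \<Longrightarrow> poly q (of_nat n) \<in> \<int>"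
  shows "poly q (of_nat n) \<in> \<int>"
  using assms
proof (induction "degree q" arbitrary: q n rule: less_induct)
  case less
  show ?case
  proof (cases "degree q = 0")
    case True
    then obtain c where "q = [:c:]" by (metis degree_eq_zeroE)
    with less.prems[of m] show ?thesis by simp
  next
    case False
    define r where "r = q \<circ>\<^sub>p [:1, 1:] - q"
    have r: "poly r (of_nat n) = poly q (of_nat (Suc n)) - poly q (of_nat n)" for n
      by (simp add: r_def poly_pcompose)
    have deg: "degree (q \<circ>\<^sub>p [:1, 1:]) = degree q" by (simp add: degree_pcompose)
    \<comment> \<open>Shifting the argument keeps the leading coefficient, so it cancels in
      \<open>r\<close> and the degree drops.\<close>
    have "coeff (q \<circ>\<^sub>p [:1, 1:]) (degree q) = coeff q (degree q)"
      using lead_coeff_comp[of "[:1, 1:]" q] by (simp add: deg)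
    then have "coeff r (degree q) = 0" by (simp add: r_def)
    moreover have "degree r \<le> degree q" unfolding r_def using deg by (intro degree_diff_le) auto
    ultimately have "degree r < degree q"
      using False by (metis coeff_0_degree_minus_1 degree_0 le_neq_implies_less leading_coeff_0_iff gr0I)
    moreover have "poly r (of_nat n) \<in> \<int>" if "n \<ge> m" for n
      unfolding r using that by (intro Ints_diff less.prems) auto
    ultimately have rint: "poly r (of_nat n) \<in> \<int>" for n using less.hyps by blast
    show ?thesis
    proof (cases "n \<ge> m")
      case True
      then show ?thesis by (rule less.prems)
    next
      case False
      then have "n \<le> m" by simp
      then show ?thesis
      proof (induction n rule: inc_induct)
        case base
        show ?case using less.prems by simp
      next
        case (step n)
        then have "poly q (of_nat (Suc n)) - poly r (of_nat n) \<in> \<int>" by (intro Ints_diff rint)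
        then show ?case by (simp add: r)
      qed
    qed
  qed
qed

lemma poly_on_progression_eventually_Ints:
  assumes "poly_on_progression h" "\<forall>\<^sub>F n in sequentially. h n \<in> \<int>"
  shows "h 0 \<in> \<int>"
proof -
  from assms(1) obtain N p where N: "N \<ge> 1" "\<And>n. h (n * N) = poly p (of_nat n)"
    unfolding poly_on_progression_def by blast
  from eventually_progression[OF N(1) assms(2)] obtain m where "\<And>n. n \<ge> m \<Longrightarrow> poly p (of_nat n) \<in> \<int>"
    by (auto simp: eventually_sequentially N(2))
  from poly_integral_on_nat[of m p 0, OF this] show ?thesis using N(2)[of 0] by simp
qed

section \<open>Polynomials and periodic polynomials along lines\<close>

lemma polynomial_function_along_line:
  fixes p :: "'a::euclidean_space \<Rightarrow> complex"
  assumes "polynomial_function p"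
  obtains q :: "complex poly" where "\<And>t::real. p (x + t *\<^sub>R v) = poly q (of_real t)"
proof -
  have "polynomial_function (\<lambda>t::real. x + t *\<^sub>R v)"
    by (intro polynomial_function_add polynomial_function_const polynomial_function_bounded_linear
        bounded_linear_scaleR_left)
  then have pol: "polynomial_function (p \<circ> (\<lambda>t::real. x + t *\<^sub>R v))"
    using assms by (rule polynomial_function_compose)
  \<comment> \<open>\<open>polynomial_function\<close> speaks of real-valued bounded linear
    functionals, so real and imaginary parts are treated apart and recombined as
    \<open>q1 + smult \<i> q2\<close>.\<close>
  have *: "\<exists>q :: complex poly. \<forall>t::real. complex_of_real (l (p (x + t *\<^sub>R v))) = poly q (of_real t)"
    if "bounded_linear l" for l :: "complex \<Rightarrow> real"
  proof -
    have "real_polynomial_function (\<lambda>t. l (p (x + t *\<^sub>R v)))"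
      using pol that by (auto simp: polynomial_function_def o_def)
    then obtain a n where an: "(\<lambda>t. l (p (x + t *\<^sub>R v))) = (\<lambda>t. \<Sum>i\<le>n. a i * t ^ i)"
      using real_polynomial_function_imp_sum by blast
    have "complex_of_real (l (p (x + t *\<^sub>R v))) = poly (\<Sum>i\<le>n. monom (of_real (a i)) i) (of_real t)" for t
      using fun_cong[OF an, of t] by (simp add: poly_sum poly_monom)
    then show ?thesis by blast
  qed
  obtain q1 q2 :: "complex poly" where
    "\<And>t. of_real (Re (p (x + t *\<^sub>R v))) = poly q1 (of_real t)"
    "\<And>t. of_real (Im (p (x + t *\<^sub>R v))) = poly q2 (of_real t)"
    using *[OF bounded_linear_Re] *[OF bounded_linear_Im] by blast
  then have "p (x + t *\<^sub>R v) = poly (q1 + smult \<i> q2) (of_real t)" for t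
    by (metis (no_types, lifting) complex_eq poly_add poly_smult)
  then show ?thesis by (rule that)
qed

lemma periodic_polynomial_along_line:
  assumes f: "periodic_polynomial_on \<Xi> f" and add: "\<And>x y. x \<in> \<Xi> \<Longrightarrow> y \<in> \<Xi> \<Longrightarrow> x + y \<in> \<Xi>"
    and x: "x \<in> \<Xi>" and v: "v \<in> \<Xi>"
  shows "poly_on_progression (\<lambda>n. f (x + of_nat n *\<^sub>R v))"
proof -
  obtain N m a p where N: "N \<ge> (1::nat)"
    and a_int: "\<And>j x. j < m \<Longrightarrow> x \<in> \<Xi> \<Longrightarrow> \<exists>n::int. a j x = 2 * pi * of_int n"
    and a_add: "\<And>j x y. j < m \<Longrightarrow> x \<in> \<Xi> \<Longrightarrow> y \<in> \<Xi> \<Longrightarrow> a j (x + y) = a j x + a j y"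
    and p: "\<And>j. j < (m::nat) \<Longrightarrow> polynomial_function (p j)"
    and f_eq: "\<And>x. x \<in> \<Xi> \<Longrightarrow> f x = (\<Sum>j<m. exp (\<i> * complex_of_real (a j x / real N)) * p j x)"
    using f unfolding periodic_polynomial_on_def by blast
  have mem: "x + of_nat n *\<^sub>R v \<in> \<Xi>" for n
  proof (induction n)
    case (Suc n)
    then have "(x + of_nat n *\<^sub>R v) + v \<in> \<Xi>" using v by (rule add)
    then show ?case by (simp add: scaleR_left_distrib algebra_simps)
  qed (use x in simp)
  have a_line: "a j (x + of_nat n *\<^sub>R v) = a j x + of_nat n * a j v" if "j < m" for j n
  proof (induction n)
    case (Suc n)
    have "x + of_nat (Suc n) *\<^sub>R v = (x + of_nat n *\<^sub>R v) + v" by (simp add: algebra_simps)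
    then show ?case using a_add[OF that mem[of n] v] Suc by (simp add: algebra_simps)
  qed simp
  \<comment> \<open>Advancing \<open>n * N\<close> steps adds an integer multiple of 2 pi N to
    \<open>a j\<close>; after division by \<open>N\<close> the exponential does not see it.\<close>
  have exp_line: "exp (\<i> * complex_of_real (a j (x + of_nat (n * N) *\<^sub>R v) / real N))
      = exp (\<i> * complex_of_real (a j x / real N))" if j: "j < m" for j n
  proof -
    obtain z :: int where z: "a j v = 2 * pi * of_int z" using a_int[OF j v] by blast
    have "a j (x + of_nat (n * N) *\<^sub>R v) / real N = a j x / real N + 2 * pi * of_int (int n * z)"
      unfolding a_line[OF j] z using N by (simp add: field_simps)
    then have "\<i> * complex_of_real (a j (x + of_nat (n * N) *\<^sub>R v) / real N)
        = \<i> * complex_of_real (a j x / real N) + of_int (2 * (int n * z)) * of_real pi * \<i>"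
      by (simp add: algebra_simps)
    then show ?thesis using exp_plus_2pin[of _ "int n * z"] by (simp add: algebra_simps)
  qed
  have "\<exists>q. \<forall>n::nat. p j (x + of_nat (n * N) *\<^sub>R v) = poly q (of_nat n)" if j: "j < m" for j
  proof -
    obtain q where q: "\<And>t. p j (x + t *\<^sub>R (real N *\<^sub>R v)) = poly q (of_real t)"
      using polynomial_function_along_line[OF p[OF j]] by blast
    have "p j (x + of_nat (n * N) *\<^sub>R v) = poly q (of_nat n)" for n
      using q[of "real n"] by simp
    then show ?thesis by blast
  qed
  then obtain q where q: "\<And>j n. j < m \<Longrightarrow> p j (x + of_nat (n * N) *\<^sub>R v) = poly (q j) (of_nat n)"
    by metis
  have "f (x + of_nat (n * N) *\<^sub>R v)
      = poly (\<Sum>j<m. smult (exp (\<i> * complex_of_real (a j x / real N))) (q j)) (of_nat n)" for n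
    unfolding f_eq[OF mem] poly_sum poly_smult
    by (intro sum.cong refl arg_cong2[where f = "(*)"] exp_line q) auto
  with N show ?thesis unfolding poly_on_progression_def by blast
qed

lemma periodic_polynomial_on_cong:
  assumes "\<And>x. x \<in> \<Xi> \<Longrightarrow> f x = g x"
  shows "periodic_polynomial_on \<Xi> f \<longleftrightarrow> periodic_polynomial_on \<Xi> g"
  unfolding periodic_polynomial_on_def using assms by auto

lemma periodic_polynomial_on_zero: "periodic_polynomial_on \<Xi> (\<lambda>x. 0)"
  unfolding periodic_polynomial_on_def
  by (intro exI[of _ 1] exI[of _ 0]) auto

lemma periodic_polynomial_on_diff:
  assumes "periodic_polynomial_on \<Xi> f" "periodic_polynomial_on \<Xi> g"
  shows "periodic_polynomial_on \<Xi> (\<lambda>x. f x - g x)"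
proof -
  obtain N m a p where N: "N \<ge> (1::nat)"
    and a_int: "\<And>j x. j < m \<Longrightarrow> x \<in> \<Xi> \<Longrightarrow> \<exists>n::int. a j x = 2 * pi * of_int n"
    and a_add: "\<And>j x y. j < m \<Longrightarrow> x \<in> \<Xi> \<Longrightarrow> y \<in> \<Xi> \<Longrightarrow> a j (x + y) = a j x + a j y"
    and p: "\<And>j. j < (m::nat) \<Longrightarrow> polynomial_function (p j)"
    and f_eq: "\<And>x. x \<in> \<Xi> \<Longrightarrow> f x = (\<Sum>j<m. exp (\<i> * complex_of_real (a j x / real N)) * p j x)"
    using assms(1) unfolding periodic_polynomial_on_def by blast
  obtain M l b q where M: "M \<ge> (1::nat)"
    and b_int: "\<And>j x. j < l \<Longrightarrow> x \<in> \<Xi> \<Longrightarrow> \<exists>n::int. b j x = 2 * pi * of_int n"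
    and b_add: "\<And>j x y. j < l \<Longrightarrow> x \<in> \<Xi> \<Longrightarrow> y \<in> \<Xi> \<Longrightarrow> b j (x + y) = b j x + b j y"
    and q: "\<And>j. j < (l::nat) \<Longrightarrow> polynomial_function (q j)"
    and g_eq: "\<And>x. x \<in> \<Xi> \<Longrightarrow> g x = (\<Sum>j<l. exp (\<i> * complex_of_real (b j x / real M)) * q j x)"
    using assms(2) unfolding periodic_polynomial_on_def by blast
  \<comment> \<open>The two families of terms are concatenated over the common denominator
    \<open>N * M\<close>, which rescales their frequencies by \<open>M\<close> and
    \<open>N\<close>.\<close>
  define c where "c j x = (if j < m then real M * a j x else real N * b (j - m) x)" for j x
  define r where "r j x = (if j < m then p j x else - q (j - m) x)" for j x
  have split: "(\<Sum>j<m + l. h j) = (\<Sum>j<m. h j) + (\<Sum>j<l. h (j + m))" for h :: "nat \<Rightarrow> complex"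
    by (induction l) (auto simp: algebra_simps)
  show ?thesis
    unfolding periodic_polynomial_on_def
  proof (rule exI[of _ "N * M"], rule exI[of _ "m + l"], rule exI[of _ c], rule exI[of _ r],
      intro conjI allI impI ballI)
    show "1 \<le> N * M" using N M by simp
  next
    fix j x assume j: "j < m + l" and x: "x \<in> \<Xi>"
    show "\<exists>n::int. c j x = 2 * pi * of_int n"
    proof (cases "j < m")
      case True
      then obtain n :: int where "a j x = 2 * pi * of_int n" using a_int x by blast
      then have "c j x = 2 * pi * of_int (int M * n)" using True by (simp add: c_def)
      then show ?thesis by blast
    next
      case False
      then obtain n :: int where "b (j - m) x = 2 * pi * of_int n" using b_int[of "j - m" x] x j by fastforce
      then have "c j x = 2 * pi * of_int (int N * n)" using False by (simp add: c_def)
      then show ?thesis by blast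
    qed
  next
    fix j x y assume "j < m + l" "x \<in> \<Xi>" "y \<in> \<Xi>"
    then show "c j (x + y) = c j x + c j y"
      by (auto simp: c_def a_add b_add algebra_simps)
  next
    fix j assume "j < m + l"
    then show "polynomial_function (r j)"
      unfolding r_def[abs_def] using p q by (cases "j < m") auto
  next
    fix x assume x: "x \<in> \<Xi>"
    have "(\<Sum>j<m + l. exp (\<i> * complex_of_real (c j x / real (N * M))) * r j x)
       = (\<Sum>j<m. exp (\<i> * complex_of_real (a j x / real N)) * p j x)
       + (\<Sum>j<l. exp (\<i> * complex_of_real (b j x / real M)) * - q j x)"
      unfolding split using N M by (simp add: c_def r_def)
    then show "f x - g x = (\<Sum>j<m + l. exp (\<i> * complex_of_real (c j x / real (N * M))) * r j x)"
      using f_eq[OF x] g_eq[OF x] by (simp add: sum_negf)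
  qed
qed

section \<open>Chambers and walls\<close>

lemma convex_cone_hull_finite:
  assumes "finite B" "x \<in> convex_cone hull B"
  obtains c where "\<And>b. b \<in> B \<Longrightarrow> c b \<ge> 0" "x = (\<Sum>b\<in>B. c b *\<^sub>R b)"
proof -
  let ?C = "{\<Sum>b\<in>B. c b *\<^sub>R b | c. \<forall>b\<in>B. c b \<ge> 0}"
  \<comment> \<open>The nonnegative combinations already form a convex cone containing
    \<open>B\<close>, so the hull cannot be larger.\<close>
  have "convex_cone hull B \<subseteq> ?C"
  proof (rule hull_minimal)
    show "B \<subseteq> ?C"
    proof
      fix b assume b: "b \<in> B"
      have "(\<Sum>a\<in>B. (if a = b then 1 else 0) *\<^sub>R a) = (\<Sum>a\<in>B. if a = b then a else 0)"
        by (rule sum.cong) auto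
      also have "\<dots> = b" using b assms(1) by (simp add: sum.delta)
      finally have "b = (\<Sum>a\<in>B. (if a = b then 1 else 0) *\<^sub>R a)" ..
      then show "b \<in> ?C" by (intro CollectI exI[of _ "\<lambda>a. if a = b then 1 else 0"]) auto
    qed
    show "convex_cone ?C"
      unfolding convex_cone_iff
    proof (intro conjI ballI allI impI)
      show "0 \<in> ?C" by (intro CollectI exI[of _ "\<lambda>_. 0"]) auto
    next
      fix x y assume "x \<in> ?C" "y \<in> ?C"
      then obtain c d where "\<forall>b\<in>B. c b \<ge> 0" "\<forall>b\<in>B. d b \<ge> 0"
        "x = (\<Sum>b\<in>B. c b *\<^sub>R b)" "y = (\<Sum>b\<in>B. d b *\<^sub>R b)" by blast
      then show "x + y \<in> ?C"
        by (intro CollectI exI[of _ "\<lambda>b. c b + d b"]) (auto simp: scaleR_left_distrib sum.distrib)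
    next
      fix x and t :: real assume "x \<in> ?C" "t \<ge> 0"
      then obtain c where "\<forall>b\<in>B. c b \<ge> 0" "x = (\<Sum>b\<in>B. c b *\<^sub>R b)" by blast
      with \<open>t \<ge> 0\<close> show "t *\<^sub>R x \<in> ?C"
        by (intro CollectI exI[of _ "\<lambda>b. t * c b"]) (auto simp: scaleR_sum_right)
    qed
  qed
  with assms(2) have "x \<in> ?C" by blast
  with that show ?thesis by blast
qed

lemma nonneg_combination_in_convex_cone_hull:
  assumes "\<And>i. i \<in> A \<Longrightarrow> c i \<ge> 0" "\<And>i. i \<in> A \<Longrightarrow> f i \<in> B"
  shows "(\<Sum>i\<in>A. c i *\<^sub>R f i) \<in> convex_cone hull B"
  using assms
proof (induction A rule: infinite_finite_induct)
  case (insert i A)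
  then show ?case by (simp add: convex_cone_hull_add convex_cone_hull_mul hull_inc)
qed (simp_all add: convex_cone_hull_contains_0)

text \<open>Generators are removed as long as \<open>x\<close> stays in the cone of the rest. At a
  minimal set every coefficient is positive, and a linear dependence would allow one more
  removal.\<close>

lemma conic_caratheodory:
  fixes B :: "'a::euclidean_space set"
  assumes "finite B" "x \<in> convex_cone hull B"
  shows "\<exists>C c. C \<subseteq> B \<and> independent C \<and> (\<forall>b\<in>C. c b > 0) \<and> x = (\<Sum>b\<in>C. c b *\<^sub>R b)"
  using assms
proof (induction B rule: finite_psubset_induct)
  case (psubset B)
  show ?case
  proof (cases "\<exists>b\<in>B. x \<in> convex_cone hull (B - {b})")
    case True
    then obtain b where "b \<in> B" "x \<in> convex_cone hull (B - {b})" by blast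
    then show ?thesis using psubset.IH[of "B - {b}"] by blast
  next
    case False
    obtain c where c: "\<And>b. b \<in> B \<Longrightarrow> c b \<ge> 0" "x = (\<Sum>b\<in>B. c b *\<^sub>R b)"
      using convex_cone_hull_finite[OF psubset.hyps psubset.prems] by blast
    have drop: False if "b \<in> B" "\<And>a. a \<in> B \<Longrightarrow> e a \<ge> 0" "x = (\<Sum>a\<in>B. e a *\<^sub>R a)" "e b = 0" for b e
    proof -
      have "x = (\<Sum>a\<in>B - {b}. e a *\<^sub>R a)"
        using that psubset.hyps by (simp add: sum.remove[of B b])
      also have "\<dots> \<in> convex_cone hull (B - {b})"
        using that by (intro nonneg_combination_in_convex_cone_hull) auto
      finally show False using False that(1) by blast
    qed
    have pos: "c b > 0" if "b \<in> B" for b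
      using drop[of b c] c that by (metis less_eq_real_def)
    have "independent B"
    proof
      assume "dependent B"
      then obtain u where u: "\<exists>v\<in>B. u v \<noteq> 0" "(\<Sum>v\<in>B. u v *\<^sub>R v) = 0"
        using dependent_finite[OF psubset.hyps] by auto
      \<comment> \<open>Negating the relation if necessary gives it a positive coefficient.\<close>
      have "\<exists>u. (\<exists>v\<in>B. u v > 0) \<and> (\<Sum>v\<in>B. u v *\<^sub>R v) = 0"
      proof (cases "\<exists>v\<in>B. u v > 0")
        case False
        with u have "\<exists>v\<in>B. - u v > 0" by force
        moreover have "(\<Sum>v\<in>B. (- u v) *\<^sub>R v) = 0" using u(2) by (simp add: sum_negf)
        ultimately show ?thesis by (intro exI[of _ "\<lambda>v. - u v"] conjI)
      qed (use u in blast)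
      then obtain u where u: "\<exists>v\<in>B. u v > 0" "(\<Sum>v\<in>B. u v *\<^sub>R v) = 0" by blast
      define P where "P = {b\<in>B. u b > 0}"
      \<comment> \<open>\<open>t\<close> is the largest multiple of the relation that can be
        subtracted while all coefficients stay nonnegative; the coefficient at the minimiser becomes
        zero.\<close>
      define t where "t = Min ((\<lambda>b. c b / u b) ` P)"
      have P: "finite P" "P \<noteq> {}" using u psubset.hyps by (auto simp: P_def)
      then have "t \<in> (\<lambda>b. c b / u b) ` P" unfolding t_def by (intro Min_in) auto
      then obtain b where b: "b \<in> P" "t = c b / u b" by blast
      have t: "t \<le> c a / u a" if "a \<in> P" for a unfolding t_def using P that by auto
      have t_pos: "t > 0" using b pos by (auto simp: P_def)
      show False
      proof (rule drop[of b "\<lambda>a. c a - t * u a"])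
        show "b \<in> B" "c b - t * u b = 0" using b by (auto simp: P_def)
        show "c a - t * u a \<ge> 0" if "a \<in> B" for a
        proof (cases "u a > 0")
          case True
          with that t[of a] show ?thesis by (auto simp: P_def pos_le_divide_eq)
        next
          case False
          then have "t * u a \<le> 0" using t_pos by (simp add: mult_nonneg_nonpos)
          with c(1)[OF that] show ?thesis by linarith
        qed
        have "(\<Sum>a\<in>B. (c a - t * u a) *\<^sub>R a) = x - t *\<^sub>R (\<Sum>a\<in>B. u a *\<^sub>R a)"
          by (simp add: c(2) scaleR_left_diff_distrib sum_subtractf scaleR_sum_right)
        then show "x = (\<Sum>a\<in>B. (c a - t * u a) *\<^sub>R a)" using u by simp
      qed
    qed
    with pos c(2) show ?thesis by blast
  qed
qed

section \<open>Singular vectors and conic chambers\<close>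

lemma closed_family_cone:
  fixes \<alpha> :: "'i \<Rightarrow> 'a::euclidean_space"
  assumes "finite J"
  shows "closed (family_cone J \<alpha>)"
  unfolding family_cone_def by (intro polyhedron_imp_closed polyhedron_convex_cone_hull) (use assms in auto)

lemma closed_singular_vectors:
  fixes \<alpha> :: "'i \<Rightarrow> 'a::euclidean_space"
  assumes "finite J"
  shows "closed (singular_vectors J \<alpha>)"
  unfolding singular_vectors_def
  by (intro closed_UN) (use assms in \<open>auto intro: closed_family_cone finite_subset\<close>)

lemma family_cone_scale: "x \<in> family_cone J \<alpha> \<Longrightarrow> t \<ge> 0 \<Longrightarrow> t *\<^sub>R x \<in> family_cone J \<alpha>"
  unfolding family_cone_def by (rule convex_cone_hull_mul)

lemma family_cone_subset_span: "family_cone J \<alpha> \<subseteq> span (\<alpha> ` J)"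
  unfolding family_cone_def by (intro hull_minimal span_superset convex_cone_span)

text \<open>An independent positive representation of a nonsingular point cannot use fewer than
  \<open>DIM('a)\<close> vectors, so these form a basis; the coordinates in it are positive at
  \<open>x\<close> and remain so nearby.\<close>

lemma nonsingular_cone_interior:
  fixes \<alpha> :: "'i \<Rightarrow> 'a::euclidean_space"
  assumes J: "finite J" and x: "x \<in> family_cone J \<alpha>" "x \<notin> singular_vectors J \<alpha>"
  shows "x \<in> interior (family_cone J \<alpha>)"
proof -
  obtain C c where C: "C \<subseteq> \<alpha> ` J" "independent C" "\<And>b. b \<in> C \<Longrightarrow> c b > 0"
    and x_eq: "x = (\<Sum>b\<in>C. c b *\<^sub>R b)"
    using conic_caratheodory[of "\<alpha> ` J" x] x(1) J unfolding family_cone_def by auto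
  have fin: "finite C" using C J by (auto intro: finite_subset)
  \<comment> \<open>Singularity counts indices, not vectors, so one index is chosen for each vector
    of \<open>C\<close>.\<close>
  obtain U where U: "U \<subseteq> J" "inj_on \<alpha> U" "C = \<alpha> ` U" using C(1) by (auto simp: subset_image_inj)
  have "x \<in> family_cone U \<alpha>"
    unfolding x_eq family_cone_def U(3)[symmetric]
    by (intro nonneg_combination_in_convex_cone_hull) (use C(3) in \<open>auto intro: less_imp_le\<close>)
  then have "\<not> card C < DIM('a)"
    using x(2) U by (auto simp: singular_vectors_def card_image)
  then have span: "span C = UNIV"
    using C(2) fin by (metis card_ge_dim_independent dim_UNIV linorder_not_le top.extremum top.extremum_uniqueI subset_antisym)
  define W where "W = (\<Inter>b\<in>C. {y. representation C y b > 0})"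
  have "linear (\<lambda>y. representation C y b)" for b
    by (rule linearI) (use C(2) span in \<open>simp_all add: representation_add representation_scale\<close>)
  then have "open {y. 0 < representation C y b}" for b
    by (intro open_Collect_less continuous_intros linear_continuous_on)
       (simp add: linear_conv_bounded_linear)
  then have "open W" unfolding W_def using fin by (intro open_INT) auto
  moreover have "x \<in> W"
  proof -
    have "representation C x b = c b" if "b \<in> C" for b
    proof -
      have "representation C x b = (\<Sum>a\<in>C. c a * representation C a b)"
        unfolding x_eq using C(2) span by (simp add: representation_sum representation_scale)
      also have "\<dots> = (\<Sum>a\<in>C. if a = b then c a else 0)"
        by (rule sum.cong) (use C(2) in \<open>auto simp: representation_basis\<close>)
      finally show ?thesis using that fin by simp
    qed
    with C(3) show ?thesis by (auto simp: W_def)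
  qed
  moreover have "W \<subseteq> family_cone J \<alpha>"
  proof
    fix y assume y: "y \<in> W"
    have "y = (\<Sum>b\<in>C. representation C y b *\<^sub>R b)"
      using sum_representation_eq[OF C(2), of y C] span fin by simp
    also have "\<dots> \<in> family_cone J \<alpha>"
      unfolding family_cone_def
      by (intro nonneg_combination_in_convex_cone_hull) (use y C(1) in \<open>auto simp: W_def intro: less_imp_le\<close>)
    finally show "y \<in> family_cone J \<alpha>" .
  qed
  ultimately show ?thesis by (meson interiorI)
qed

text \<open>A chamber meeting both the cone and its complement would, being connected, contain a
  frontier point. The cone is closed, so that point lies in it, but nonsingular points of the cone
  are interior.\<close>

lemma chamber_dichotomy:
  fixes \<alpha> :: "'i \<Rightarrow> 'a::euclidean_space"
  assumes J: "finite J" and c: "c \<in> conic_chambers J \<alpha>"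
  shows "c \<subseteq> family_cone J \<alpha> \<or> c \<inter> family_cone J \<alpha> = {}"
proof (rule ccontr)
  assume "\<not> ?thesis"
  then have "c \<inter> frontier (family_cone J \<alpha>) \<noteq> {}"
    using c by (intro connected_Int_frontier) (auto simp: conic_chambers_def in_components_connected)
  then obtain x where x: "x \<in> c" "x \<in> frontier (family_cone J \<alpha>)" by blast
  moreover have "x \<notin> singular_vectors J \<alpha>"
    using c x(1) in_components_subset by (auto simp: conic_chambers_def)
  ultimately show False
    using nonsingular_cone_interior[OF J, of x \<alpha>] closed_family_cone[OF J, of \<alpha>]
    by (auto simp: frontier_def)
qed

text \<open>The singular set is invariant under positive scaling, so the open ray through
  \<open>x\<close> is connected and nonsingular and stays in the component.\<close>

lemma chamber_scale:
  fixes \<alpha> :: "'i \<Rightarrow> 'a::euclidean_space"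
  assumes c: "c \<in> conic_chambers J \<alpha>" and x: "x \<in> c" and t: "t > 0"
  shows "t *\<^sub>R x \<in> c"
proof -
  have "(\<lambda>s. s *\<^sub>R x) ` {0<..} \<subseteq> c"
  proof (rule components_maximal)
    show "c \<in> components (- singular_vectors J \<alpha>)" using c by (simp add: conic_chambers_def)
    show "connected ((\<lambda>s. s *\<^sub>R x) ` {0<..})"
      by (intro connected_continuous_image continuous_intros connected_Ioi)
    have "x \<notin> singular_vectors J \<alpha>"
      using c x in_components_subset by (auto simp: conic_chambers_def)
    moreover have "x \<in> singular_vectors J \<alpha>" if "s *\<^sub>R x \<in> singular_vectors J \<alpha>" "s > 0" for s
    proof -
      obtain \<nu> where \<nu>: "\<nu> \<subseteq> J" "card \<nu> < DIM('a)" "s *\<^sub>R x \<in> family_cone \<nu> \<alpha>"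
        using \<open>s *\<^sub>R x \<in> _\<close> by (auto simp: singular_vectors_def)
      have "(1 / s) *\<^sub>R (s *\<^sub>R x) \<in> family_cone \<nu> \<alpha>"
        by (rule family_cone_scale[OF \<nu>(3)]) (use that(2) in simp)
      with \<nu> that(2) show ?thesis by (auto simp: singular_vectors_def)
    qed
    ultimately show "(\<lambda>s. s *\<^sub>R x) ` {0<..} \<subseteq> - singular_vectors J \<alpha>" by auto
    have "x \<in> (\<lambda>s. s *\<^sub>R x) ` {0<..}" by (rule image_eqI[of _ _ 1]) auto
    with x show "c \<inter> (\<lambda>s. s *\<^sub>R x) ` {0<..} \<noteq> {}" by blast
  qed
  with t show ?thesis by auto
qed

lemma closure_chamber_scale:
  assumes c: "c \<in> conic_chambers J \<alpha>" and x: "x \<in> closure c" and t: "t > 0"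
  shows "t *\<^sub>R x \<in> closure c"
proof -
  have "t *\<^sub>R x \<in> closure ((*\<^sub>R) t ` c)" unfolding closure_scaleR[symmetric] using x by (rule imageI)
  moreover have "(*\<^sub>R) t ` c \<subseteq> c" using chamber_scale[OF c _ t] by blast
  ultimately show ?thesis using closure_mono by blast
qed

lemma mem_wall_iff:
  "x \<in> wall \<beta> c\<^sub>1 c\<^sub>2 \<longleftrightarrow>
     (\<exists>U. open U \<and> x \<in> hyperplane \<beta> \<inter> U \<and> hyperplane \<beta> \<inter> U \<subseteq> closure c\<^sub>1 \<inter> closure c\<^sub>2)"
  unfolding wall_def interior_of_def openin_open by blast

lemma wall_subset_closures: "wall \<beta> c\<^sub>1 c\<^sub>2 \<subseteq> closure c\<^sub>1 \<inter> closure c\<^sub>2"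
  unfolding wall_def by (rule interior_of_subset)

lemma wall_scale:
  assumes c: "c\<^sub>1 \<in> conic_chambers J \<alpha>" "c\<^sub>2 \<in> conic_chambers J \<alpha>"
    and x: "x \<in> wall \<beta> c\<^sub>1 c\<^sub>2" and t: "t > 0"
  shows "t *\<^sub>R x \<in> wall \<beta> c\<^sub>1 c\<^sub>2"
proof -
  obtain U where U: "open U" "x \<in> hyperplane \<beta> \<inter> U" "hyperplane \<beta> \<inter> U \<subseteq> closure c\<^sub>1 \<inter> closure c\<^sub>2"
    using x unfolding mem_wall_iff by blast
  show ?thesis
    unfolding mem_wall_iff
  proof (intro exI[of _ "(*\<^sub>R) t ` U"] conjI subsetI)
    show "open ((*\<^sub>R) t ` U)" using U(1) t by (intro open_scaling) auto
    show "t *\<^sub>R x \<in> hyperplane \<beta> \<inter> (*\<^sub>R) t ` U" using U(2) by (auto simp: hyperplane_def)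
    fix y assume "y \<in> hyperplane \<beta> \<inter> (*\<^sub>R) t ` U"
    then obtain z where "y = t *\<^sub>R z" "z \<in> hyperplane \<beta> \<inter> U" using t by (auto simp: hyperplane_def)
    with U(3) show "y \<in> closure c\<^sub>1 \<inter> closure c\<^sub>2"
      using closure_chamber_scale[OF c(1) _ t] closure_chamber_scale[OF c(2) _ t] by blast
  qed
qed

section \<open>Generic points of a subspace\<close>

lemma subspace_hyperplane: "subspace (hyperplane \<beta>)"
  by (auto simp: subspace_def hyperplane_def inner_add_left)

text \<open>From a point x of \<open>W\<close> a small step in any direction y of \<open>D\<close>
  stays in \<open>W\<close>, so both ends lie in \<open>V\<close> and hence so does y.\<close>

lemma openin_subspace_span:
  fixes D :: "'a::euclidean_space set"
  assumes "subspace D" "subspace V" and W: "openin (top_of_set D) W" "W \<noteq> {}" "W \<subseteq> V"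
  shows "D \<subseteq> V"
proof
  fix y assume y: "y \<in> D"
  obtain U where U: "open U" "W = D \<inter> U" using W(1) by (auto simp: openin_open)
  obtain x where x: "x \<in> W" using W(2) by blast
  have "((\<lambda>t. x + t *\<^sub>R y) \<longlongrightarrow> x + 0 *\<^sub>R y) (at_right (0::real))" by (intro tendsto_intros)
  then have "\<forall>\<^sub>F t in at_right (0::real). x + t *\<^sub>R y \<in> U"
    using U x by (auto dest: topological_tendstoD)
  then have "\<forall>\<^sub>F t in at_right (0::real). x + t *\<^sub>R y \<in> U \<and> t > 0"
    by (rule eventually_conj) (simp add: eventually_at_right_less)
  then obtain t :: real where t: "x + t *\<^sub>R y \<in> U" "t > 0"
    using eventually_happens'[OF trivial_limit_at_right_real] by blast
  have "x + t *\<^sub>R y \<in> V" using t U x y assms(1) W(3) by (auto intro: subspace_add subspace_scale)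
  then have "(x + t *\<^sub>R y) - x \<in> V" using x W(3) assms(2) by (blast intro: subspace_diff)
  then have "(1 / t) *\<^sub>R (t *\<^sub>R y) \<in> V" using subspace_scale[OF assms(2), of "t *\<^sub>R y" "1 / t"] by simp
  then show "y \<in> V" using t(2) by simp
qed

text \<open>The subspaces are removed one at a time: each is closed, and by
  \<open>openin_subspace_span\<close> none can swallow a nonempty relatively open set.\<close>

lemma openin_subspace_avoid:
  fixes D :: "'a::euclidean_space set"
  assumes "finite F" "subspace D" and W: "openin (top_of_set D) W" "W \<noteq> {}"
    and F: "\<And>V. V \<in> F \<Longrightarrow> subspace V \<and> \<not> D \<subseteq> V"
  shows "openin (top_of_set D) (W - \<Union>F) \<and> W - \<Union>F \<noteq> {}"
  using assms(1) F
proof (induction F rule: finite_induct)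
  case empty
  then show ?case using W by simp
next
  case (insert V F)
  then have IH: "openin (top_of_set D) (W - \<Union>F)" "W - \<Union>F \<noteq> {}" and V: "subspace V" "\<not> D \<subseteq> V"
    by auto
  have eq: "W - \<Union>(insert V F) = (W - \<Union>F) - V" by auto
  have "openin (top_of_set D) ((W - \<Union>F) \<inter> - V)"
    by (intro openin_Int_open IH) (use V closed_subspace in auto)
  then have "openin (top_of_set D) ((W - \<Union>F) - V)" by (simp add: Diff_eq)
  moreover have "(W - \<Union>F) - V \<noteq> {}"
    using openin_subspace_span[OF assms(2) V(1) IH] V(2) by blast
  ultimately show ?case unfolding eq by blast
qed

section \<open>Full lattices and rational approximation\<close>

lemma full_lattice_add:
  assumes "full_lattice L" "x \<in> L" "y \<in> L"
  shows "x + y \<in> L"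
proof -
  obtain B where L: "L = {\<Sum>b\<in>B. of_int (z b) *\<^sub>R b | z :: 'a \<Rightarrow> int. True}"
    using assms(1) unfolding full_lattice_def by blast
  obtain z w where "x = (\<Sum>b\<in>B. of_int (z b) *\<^sub>R b)" "y = (\<Sum>b\<in>B. of_int (w b) *\<^sub>R b)"
    using assms(2,3) unfolding L by blast
  then have "x + y = (\<Sum>b\<in>B. of_int (z b + w b) *\<^sub>R b)"
    by (simp add: scaleR_left_distrib sum.distrib)
  then show ?thesis unfolding L by (intro CollectI exI[of _ "\<lambda>b. z b + w b"] conjI TrueI)
qed

lemma full_lattice_scale:
  assumes "full_lattice L" "x \<in> L"
  shows "of_int k *\<^sub>R x \<in> L"
proof -
  obtain B where L: "L = {\<Sum>b\<in>B. of_int (z b) *\<^sub>R b | z :: 'a \<Rightarrow> int. True}"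
    using assms(1) unfolding full_lattice_def by blast
  obtain z where "x = (\<Sum>b\<in>B. of_int (z b) *\<^sub>R b)"
    using assms(2) unfolding L by blast
  then have "of_int k *\<^sub>R x = (\<Sum>b\<in>B. of_int (k * z b) *\<^sub>R b)"
    by (simp add: scaleR_sum_right)
  then show ?thesis unfolding L by (intro CollectI exI[of _ "\<lambda>b. k * z b"] conjI TrueI)
qed

lemma full_lattice_zero: "full_lattice L \<Longrightarrow> 0 \<in> L"
  unfolding full_lattice_def by (auto intro!: exI[of _ "\<lambda>_. 0"])

lemma full_lattice_diff: "full_lattice L \<Longrightarrow> x \<in> L \<Longrightarrow> y \<in> L \<Longrightarrow> x - y \<in> L"
  using full_lattice_add[of L x "- y"] full_lattice_scale[of L y "-1"] by simp

lemma full_lattice_sum: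
  assumes "full_lattice L" "\<And>i. i \<in> A \<Longrightarrow> f i \<in> L"
  shows "sum f A \<in> L"
  using assms(2)
  by (induction A rule: infinite_finite_induct) (auto intro: full_lattice_zero full_lattice_add assms(1))

lemma floor_multiple_over_tendsto: "(\<lambda>n. of_int \<lfloor>real n * c\<rfloor> / real n) \<longlonglongrightarrow> c"
proof (rule tendsto_sandwich)
  show "\<forall>\<^sub>F n in sequentially. c - 1 / real n \<le> of_int \<lfloor>real n * c\<rfloor> / real n"
    using eventually_gt_at_top[of 0]
  proof eventually_elim
    case (elim n)
    have "real n * c - 1 \<le> of_int \<lfloor>real n * c\<rfloor>" by linarith
    then have "(real n * c - 1) / real n \<le> of_int \<lfloor>real n * c\<rfloor> / real n" by (rule divide_right_mono) simp
    then show ?case using elim by (simp add: diff_divide_distrib)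
  qed
  show "\<forall>\<^sub>F n in sequentially. of_int \<lfloor>real n * c\<rfloor> / real n \<le> c"
    using eventually_gt_at_top[of 0]
  proof eventually_elim
    case (elim n)
    have "of_int \<lfloor>real n * c\<rfloor> \<le> real n * c" by linarith
    then show ?case using elim by (simp add: field_simps)
  qed
  have "(\<lambda>n. c - 1 / real n) \<longlonglongrightarrow> c - 0" by (intro tendsto_intros lim_1_over_n)
  then show "(\<lambda>n. c - 1 / real n) \<longlonglongrightarrow> c" by simp
qed simp

text \<open>Rounding the coefficients down to multiples of 1/n keeps the point in the span and, for
  large n, near \<open>x\<close>; multiplying by n clears the denominators.\<close>

lemma rational_approximation_in_span:
  fixes B :: "'a::euclidean_space set"
  assumes L: "full_lattice L" and B: "finite B" "B \<subseteq> L" and x: "x \<in> span B" "x \<in> U" "open U"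
  obtains m :: nat and y where "m \<ge> 1" "y \<in> U" "y \<in> span B" "of_nat m *\<^sub>R y \<in> L"
proof -
  obtain c where c: "x = (\<Sum>b\<in>B. c b *\<^sub>R b)" using x(1) by (auto simp: span_finite[OF B(1)])
  define y where "y n = (\<Sum>b\<in>B. (of_int \<lfloor>real n * c b\<rfloor> / real n) *\<^sub>R b)" for n
  have "y \<longlonglongrightarrow> x"
    unfolding y_def[abs_def] c by (intro tendsto_intros floor_multiple_over_tendsto)
  then have "\<forall>\<^sub>F n in sequentially. y n \<in> U \<and> n \<ge> 1"
    using x by (intro eventually_conj topological_tendstoD eventually_ge_at_top)
  then obtain n where n: "y n \<in> U" "n \<ge> 1" using eventually_happens'[OF sequentially_bot] by blast
  have "of_nat n *\<^sub>R y n = (\<Sum>b\<in>B. of_int \<lfloor>real n * c b\<rfloor> *\<^sub>R b)"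
    unfolding y_def scaleR_sum_right using n by simp
  also have "\<dots> \<in> L" using B by (intro full_lattice_sum[OF L] full_lattice_scale[OF L]) auto
  finally have "of_nat n *\<^sub>R y n \<in> L" .
  moreover have "y n \<in> span B" unfolding y_def by (intro span_sum span_scale span_base)
  ultimately show ?thesis using n that by blast
qed

text \<open>A nonsingular point lies in an open component; being in the closures of both chambers,
  it would force both to be that component, although they differ.\<close>

lemma wall_singular:
  fixes \<alpha> :: "'i \<Rightarrow> 'a::euclidean_space"
  assumes J: "finite J" and adj: "adjacent_chambers J \<alpha> \<beta> c\<^sub>1 c\<^sub>2" and x: "x \<in> wall \<beta> c\<^sub>1 c\<^sub>2"
  shows "x \<in> singular_vectors J \<alpha>"
proof (rule ccontr)
  let ?N = "- singular_vectors J \<alpha>"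
  assume "x \<notin> singular_vectors J \<alpha>"
  then have "x \<in> \<Union>(components ?N)" using Union_components[of ?N] by simp
  then obtain c where c: "c \<in> components ?N" "x \<in> c" by blast
  have "open c" using c(1) closed_singular_vectors[OF J, of \<alpha>] by (auto intro: open_components)
  have "c' = c" if "c' \<in> components ?N" "x \<in> closure c'" for c'
  proof -
    have "c \<inter> c' \<noteq> {}" using \<open>open c\<close> c(2) that(2) by (auto simp: closure_iff_nhds_not_empty)
    then show ?thesis using components_nonoverlap[OF c(1) that(1)] by blast
  qed
  moreover have "x \<in> closure c\<^sub>1" "x \<in> closure c\<^sub>2" using x wall_subset_closures by blast+
  ultimately show False using adj by (auto simp: adjacent_chambers_def conic_chambers_def)
qed

text \<open>\<open>v\<close> is an integer multiple of a wall point near which all singular vectors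
  lie in the hyperplane. For large n the point x + n v is a positive multiple of a point near that
  one, so the sign of \<open>x \<bullet> \<beta>\<close> decides where it lands.\<close>

lemma wall_direction:
  fixes \<alpha> :: "'i \<Rightarrow> 'a::euclidean_space"
  assumes L: "full_lattice L" and J: "finite J" and \<alpha>: "\<And>j. j \<in> J \<Longrightarrow> \<alpha> j \<in> L" and \<beta>: "\<beta> \<noteq> 0"
    and adj: "adjacent_chambers J \<alpha> \<beta> c\<^sub>1 c\<^sub>2"
    and c1: "c\<^sub>1 \<subseteq> {\<xi>. \<xi> \<bullet> \<beta> > 0}" and c2: "c\<^sub>2 \<subseteq> {\<xi>. \<xi> \<bullet> \<beta> < 0}"
  obtains v where "v \<in> L" "v \<in> hyperplane \<beta>"
    "\<And>x. x \<bullet> \<beta> > 0 \<Longrightarrow> \<forall>\<^sub>F n in sequentially. x + of_nat n *\<^sub>R v \<in> c\<^sub>1"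
    "\<And>x. x \<bullet> \<beta> < 0 \<Longrightarrow> \<forall>\<^sub>F n in sequentially. x + of_nat n *\<^sub>R v \<in> c\<^sub>2"
    "\<And>x. x \<bullet> \<beta> = 0 \<Longrightarrow> \<forall>\<^sub>F n in sequentially. x + of_nat n *\<^sub>R v \<in> wall \<beta> c\<^sub>1 c\<^sub>2"
proof -
  let ?D = "hyperplane \<beta>" and ?W = "wall \<beta> c\<^sub>1 c\<^sub>2"
  have ch: "c\<^sub>1 \<in> conic_chambers J \<alpha>" "c\<^sub>2 \<in> conic_chambers J \<alpha>" and Wne: "?W \<noteq> {}"
    using adj by (auto simp: adjacent_chambers_def)
  have Wop: "openin (top_of_set ?D) ?W" unfolding wall_def by (rule openin_interior_of)
  \<comment> \<open>These are the small subfamilies whose span does not contain the hyperplane; a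
    generic wall point avoids all their spans. Every other small subfamily spans exactly the
    hyperplane, by dimension.\<close>
  define bad where "bad = {\<nu>. \<nu> \<subseteq> J \<and> card \<nu> < DIM('a) \<and> \<not> ?D \<subseteq> span (\<alpha> ` \<nu>)}"
  have bad_fin: "finite bad" unfolding bad_def using J by (auto intro: finite_subset[of _ "Pow J"])
  have good: "span (\<alpha> ` \<nu>) = ?D" if "\<nu> \<subseteq> J" "card \<nu> < DIM('a)" "\<nu> \<notin> bad" for \<nu>
  proof -
    have "?D = {x. \<beta> \<bullet> x = 0}" by (auto simp: hyperplane_def inner_commute)
    then have dimD: "dim ?D = DIM('a) - 1" using \<beta> by (simp add: dim_hyperplane)
    have "dim (span (\<alpha> ` \<nu>)) \<le> card (\<alpha> ` \<nu>)"
      using that(1) J by (simp add: dim_le_card' finite_subset)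
    also have "\<dots> \<le> card \<nu>" using that(1) J by (simp add: card_image_le finite_subset)
    finally have "dim (span (\<alpha> ` \<nu>)) \<le> dim ?D" using that(2) dimD by linarith
    then show ?thesis
      using that by (intro subspace_dim_equal[symmetric] subspace_hyperplane subspace_span) (auto simp: bad_def)
  qed
  let ?W' = "?W - \<Union>((\<lambda>\<nu>. span (\<alpha> ` \<nu>)) ` bad)"
  have "openin (top_of_set ?D) ?W' \<and> ?W' \<noteq> {}"
    by (intro openin_subspace_avoid Wop Wne subspace_hyperplane finite_imageI bad_fin)
       (auto simp: bad_def)
  then obtain x U where U: "open U" "?W' = ?D \<inter> U" and x: "x \<in> ?W'"
    by (auto simp only: openin_open)
  \<comment> \<open>Wall points are singular and \<open>x\<close> avoids the bad spans, so some good
    \<nu> exists. Its lattice vectors span the hyperplane, which makes rational points dense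
    there.\<close>
  have "x \<in> singular_vectors J \<alpha>" using x wall_singular[OF J adj] by blast
  then obtain \<nu> where \<nu>: "\<nu> \<subseteq> J" "card \<nu> < DIM('a)" "x \<in> family_cone \<nu> \<alpha>"
    by (auto simp: singular_vectors_def)
  have x_span: "x \<in> span (\<alpha> ` \<nu>)" using \<nu>(3) family_cone_subset_span by blast
  then have "\<nu> \<notin> bad" using x by blast
  then have span_\<nu>: "span (\<alpha> ` \<nu>) = ?D" using good \<nu> by blast
  have "x \<in> U" using x U by blast
  obtain m y where m: "m \<ge> 1" and y: "y \<in> U" "y \<in> ?D" and my: "of_nat m *\<^sub>R y \<in> L"
    using rational_approximation_in_span[OF L _ _ x_span \<open>x \<in> U\<close> U(1)] \<nu>(1) \<alpha> J span_\<nu>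
    by (metis (no_types, lifting) finite_imageI finite_subset image_subset_iff subsetD)
  define v where "v = of_nat m *\<^sub>R y"
  have y_W': "y \<in> ?W'" using y U by blast
  \<comment> \<open>Removing finitely many closed cones leaves an open set around \<open>y\<close>;
    a singular vector in it comes from a good subfamily and hence lies in the hyperplane.\<close>
  define V where "V = U - (\<Union>\<nu>\<in>bad. family_cone \<nu> \<alpha>)"
  have "closed (\<Union>\<nu>\<in>bad. family_cone \<nu> \<alpha>)"
    by (intro closed_UN bad_fin ballI closed_family_cone) (use J in \<open>auto simp: bad_def intro: finite_subset\<close>)
  then have "open V" unfolding V_def using U(1) by blast
  moreover have "y \<in> V" using y y_W' family_cone_subset_span unfolding V_def by blast
  ultimately obtain e where e: "e > 0" "ball y e \<subseteq> V" by (auto simp: open_contains_ball)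
  have nonsing: "z \<notin> singular_vectors J \<alpha>" if "z \<in> ball y e" "z \<bullet> \<beta> \<noteq> 0" for z
  proof
    assume "z \<in> singular_vectors J \<alpha>"
    then obtain \<nu> where \<nu>: "\<nu> \<subseteq> J" "card \<nu> < DIM('a)" "z \<in> family_cone \<nu> \<alpha>"
      by (auto simp: singular_vectors_def)
    then have "\<nu> \<notin> bad" using that e(2) by (auto simp: V_def)
    then have "z \<in> ?D" using good \<nu> family_cone_subset_span by blast
    with that(2) show False by (simp add: hyperplane_def)
  qed
  have y_cl: "y \<in> closure c\<^sub>1" "y \<in> closure c\<^sub>2" using y_W' wall_subset_closures by blast+
  \<comment> \<open>The half ball is connected and nonsingular, and it meets \<open>c\<close>
    because its centre lies in the closure of \<open>c\<close> and \<open>c\<close> is inside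
    \<open>H\<close>.\<close>
  have half: "ball y e \<inter> H \<subseteq> c"
    if "c \<in> conic_chambers J \<alpha>" "y \<in> closure c" "c \<subseteq> H" "convex H" "\<And>z. z \<in> H \<Longrightarrow> z \<bullet> \<beta> \<noteq> 0" for c H
  proof (rule components_maximal)
    show "c \<in> components (- singular_vectors J \<alpha>)" using that(1) by (simp add: conic_chambers_def)
    show "connected (ball y e \<inter> H)" using that(4) by (intro convex_connected convex_Int) auto
    show "ball y e \<inter> H \<subseteq> - singular_vectors J \<alpha>" using nonsing that(5) by blast
    have "y \<in> ball y e \<inter> closure c" using that(2) e(1) by simp
    then have "ball y e \<inter> c \<noteq> {}" using open_Int_closure_eq_empty[of "ball y e" c] by blast
    then show "c \<inter> (ball y e \<inter> H) \<noteq> {}" using that(3) by blast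
  qed
  have half1: "ball y e \<inter> {\<xi>. \<xi> \<bullet> \<beta> > 0} \<subseteq> c\<^sub>1"
    by (rule half[OF ch(1) y_cl(1) c1]) (simp_all add: convex_halfspace_gt inner_commute[of _ \<beta>])
  have half2: "ball y e \<inter> {\<xi>. \<xi> \<bullet> \<beta> < 0} \<subseteq> c\<^sub>2"
    by (rule half[OF ch(2) y_cl(2) c2]) (simp_all add: convex_halfspace_lt inner_commute[of _ \<beta>])
  have ball_wall: "ball y e \<inter> ?D \<subseteq> ?W" using e(2) U(2) unfolding V_def by blast
  \<comment> \<open>With t = n m, x + n v equals t (y + x / t), and the bracket tends to
    \<open>y\<close>; since \<beta> vanishes on \<open>y\<close>, the \<beta>-values are related as
    stated.\<close>
  have ev: "\<forall>\<^sub>F n in sequentially. \<exists>t>0. \<exists>z\<in>ball y e. x + of_nat n *\<^sub>R v = t *\<^sub>R z \<and> t * (z \<bullet> \<beta>) = x \<bullet> \<beta>" for x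
  proof -
    have "(\<lambda>n. y + (1 / real n) *\<^sub>R (x /\<^sub>R real m)) \<longlonglongrightarrow> y + 0 *\<^sub>R (x /\<^sub>R real m)"
      by (intro tendsto_intros lim_1_over_n)
    then have "\<forall>\<^sub>F n in sequentially. y + (1 / real n) *\<^sub>R (x /\<^sub>R real m) \<in> ball y e"
      using e(1) by (intro topological_tendstoD[of _ "y + 0 *\<^sub>R (x /\<^sub>R real m)"]) auto
    then show ?thesis using eventually_gt_at_top[of 0]
    proof eventually_elim
      case (elim n)
      let ?z = "y + (1 / real n) *\<^sub>R (x /\<^sub>R real m)" and ?t = "real n * real m"
      have t: "?t > 0" using elim(2) m by simp
      moreover have eq: "x + of_nat n *\<^sub>R v = ?t *\<^sub>R ?z"
        using elim(2) m by (simp add: v_def algebra_simps)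
      moreover have "?t * (?z \<bullet> \<beta>) = x \<bullet> \<beta>"
        using y(2) elim(2) m by (simp add: hyperplane_def inner_add_left)
      ultimately show ?case using elim(1) by blast
    qed
  qed
  show ?thesis
  proof (rule that[of v])
    show "v \<in> L" using my by (simp add: v_def)
    show "v \<in> ?D" using y(2) by (simp add: v_def hyperplane_def)
  next
    fix x assume x: "x \<bullet> \<beta> > 0"
    show "\<forall>\<^sub>F n in sequentially. x + of_nat n *\<^sub>R v \<in> c\<^sub>1"
      using ev[of x]
    proof eventually_elim
      case (elim n)
      then obtain t z where t: "t > 0" "z \<in> ball y e" "x + of_nat n *\<^sub>R v = t *\<^sub>R z" "t * (z \<bullet> \<beta>) = x \<bullet> \<beta>"
        by blast
      then have "z \<bullet> \<beta> > 0" using x by (metis zero_less_mult_pos)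
      then show ?case using t half1 chamber_scale[OF ch(1)] by auto
    qed
  next
    fix x assume x: "x \<bullet> \<beta> < 0"
    show "\<forall>\<^sub>F n in sequentially. x + of_nat n *\<^sub>R v \<in> c\<^sub>2"
      using ev[of x]
    proof eventually_elim
      case (elim n)
      then obtain t z where t: "t > 0" "z \<in> ball y e" "x + of_nat n *\<^sub>R v = t *\<^sub>R z" "t * (z \<bullet> \<beta>) = x \<bullet> \<beta>"
        by blast
      then have "z \<bullet> \<beta> < 0" using x by (metis mult_less_0_iff not_less_iff_gr_or_eq)
      then show ?case using t half2 chamber_scale[OF ch(2)] by auto
    qed
  next
    fix x assume x: "x \<bullet> \<beta> = 0"
    show "\<forall>\<^sub>F n in sequentially. x + of_nat n *\<^sub>R v \<in> ?W"
      using ev[of x]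
    proof eventually_elim
      case (elim n)
      then obtain t z where t: "t > 0" "z \<in> ball y e" "x + of_nat n *\<^sub>R v = t *\<^sub>R z" "t * (z \<bullet> \<beta>) = x \<bullet> \<beta>"
        by blast
      then have "z \<in> ?D" using x by (simp add: hyperplane_def)
      then show ?case using t ball_wall wall_scale[OF ch] by auto
    qed
  qed
qed

section \<open>Wall crossing\<close>

lemma vector_partition_nonzero_inner:
  fixes a :: "'i \<Rightarrow> 'a::euclidean_space"
  assumes "\<And>j. j \<in> S \<Longrightarrow> a j \<bullet> \<beta> \<ge> 0" "vector_partition S a x \<noteq> 0"
  shows "x \<bullet> \<beta> \<ge> 0"
proof -
  obtain k :: "'i \<Rightarrow> nat" where "x = (\<Sum>j\<in>S. of_nat (k j) *\<^sub>R a j)"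
    using assms(2) by (rule vector_partition_nonzeroE)
  then show ?thesis using assms(1) by (simp add: inner_sum_left sum_nonneg)
qed

lemma vector_partition_nonzero_hyperplane:
  fixes a :: "'i \<Rightarrow> 'a::euclidean_space"
  assumes "\<And>j. j \<in> S \<Longrightarrow> a j \<in> hyperplane \<beta>" "vector_partition S a x \<noteq> 0"
  shows "x \<bullet> \<beta> = 0"
proof -
  obtain k :: "'i \<Rightarrow> nat" where "x = (\<Sum>j\<in>S. of_nat (k j) *\<^sub>R a j)"
    using assms(2) by (rule vector_partition_nonzeroE)
  then show ?thesis using assms(1) by (simp add: inner_sum_left hyperplane_def)
qed

lemma vector_partition_nonzero_cone:
  fixes a :: "'i \<Rightarrow> 'a::euclidean_space"
  assumes "vector_partition S a x \<noteq> 0"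
  shows "x \<in> family_cone S a"
proof -
  obtain k :: "'i \<Rightarrow> nat" where "x = (\<Sum>j\<in>S. of_nat (k j) *\<^sub>R a j)"
    using assms by (rule vector_partition_nonzeroE)
  then show ?thesis
    unfolding family_cone_def by (auto intro!: nonneg_combination_in_convex_cone_hull)
qed

text \<open>Translation along the hyperplane does not change the \<beta>-value, which bounds the
  multiplicities, and \<gamma> is recovered from these. The sign \<epsilon> accommodates both halves
  of the kernel.\<close>

lemma finite_partition_support:
  fixes a :: "'i \<Rightarrow> 'a::euclidean_space"
  assumes S: "finite S" "\<And>j. j \<in> S \<Longrightarrow> a j \<bullet> \<beta> > 0" and \<Gamma>: "\<Gamma> \<subseteq> hyperplane \<beta>"
    and \<epsilon>: "\<epsilon> * \<epsilon> = (1::real)"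
  shows "finite {\<gamma>\<in>\<Gamma>. vector_partition S a (x + \<epsilon> *\<^sub>R \<gamma>) \<noteq> 0}"
proof (rule finite_subset)
  let ?K = "{k \<in> S \<rightarrow>\<^sub>E (UNIV :: nat set). (\<Sum>j\<in>S. real (k j) * (a j \<bullet> \<beta>)) \<le> x \<bullet> \<beta>}"
  show "finite ((\<lambda>k. \<epsilon> *\<^sub>R ((\<Sum>j\<in>S. of_nat (k j) *\<^sub>R a j) - x)) ` ?K)"
    by (intro finite_imageI finite_bounded_multiplicities) (use S in auto)
  show "{\<gamma>\<in>\<Gamma>. vector_partition S a (x + \<epsilon> *\<^sub>R \<gamma>) \<noteq> 0}
      \<subseteq> (\<lambda>k. \<epsilon> *\<^sub>R ((\<Sum>j\<in>S. of_nat (k j) *\<^sub>R a j) - x)) ` ?K"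
  proof
    fix \<gamma> assume "\<gamma> \<in> {\<gamma>\<in>\<Gamma>. vector_partition S a (x + \<epsilon> *\<^sub>R \<gamma>) \<noteq> 0}"
    then have \<gamma>: "\<gamma> \<bullet> \<beta> = 0" "vector_partition S a (x + \<epsilon> *\<^sub>R \<gamma>) \<noteq> 0"
      using \<Gamma> by (auto simp: hyperplane_def)
    obtain k where k: "k \<in> S \<rightarrow>\<^sub>E UNIV" "x + \<epsilon> *\<^sub>R \<gamma> = (\<Sum>j\<in>S. of_nat (k j) *\<^sub>R a j)"
      using \<gamma>(2) by (rule vector_partition_nonzeroE)
    have "\<epsilon> *\<^sub>R ((\<Sum>j\<in>S. of_nat (k j) *\<^sub>R a j) - x) = \<gamma>"
      unfolding k(2)[symmetric] using \<epsilon> by simp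
    moreover have "(\<Sum>j\<in>S. real (k j) * (a j \<bullet> \<beta>)) = (x + \<epsilon> *\<^sub>R \<gamma>) \<bullet> \<beta>"
      unfolding k(2) by (simp add: inner_sum_left)
    then have "k \<in> ?K" using k(1) \<gamma>(1) by (simp add: inner_add_left)
    ultimately show "\<gamma> \<in> (\<lambda>k. \<epsilon> *\<^sub>R ((\<Sum>j\<in>S. of_nat (k j) *\<^sub>R a j) - x)) ` ?K" by (intro image_eqI[of _ _ k]) simp_all
  qed
qed

lemma eventually_gt_linear:
  fixes w :: real
  assumes "w > 0"
  shows "\<forall>\<^sub>F n in sequentially. C < x + real n * w"
proof -
  obtain m :: nat where m: "(C - x) / w < real m" using reals_Archimedean2 by blast
  show ?thesis
    using eventually_ge_at_top[of m]
  proof eventually_elim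
    case (elim n)
    with m have "(C - x) / w < real n" by linarith
    then have "C - x < real n * w" using assms by (simp add: pos_divide_less_eq)
    then show ?case by linarith
  qed
qed

text \<open>Removing a nonempty sum lowers the \<beta>-value by at least a fixed
  \<open>m > 0\<close>, so an induction over strips of width \<open>m\<close> reaches every point of
  \<open>L\<close> from the negative half-space.\<close>

lemma half_space_induct:
  fixes a :: "'i \<Rightarrow> 'a::euclidean_space"
  assumes S: "finite S" "\<And>j. j \<in> S \<Longrightarrow> a j \<bullet> \<beta> > 0"
    and closed: "\<And>\<mu> I. \<mu> \<in> L \<Longrightarrow> I \<subseteq> S \<Longrightarrow> \<mu> - sum a I \<in> L"
    and base: "\<And>\<mu>. \<mu> \<in> L \<Longrightarrow> \<mu> \<bullet> \<beta> < 0 \<Longrightarrow> Q \<mu>"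
    and step: "\<And>\<mu>. \<mu> \<in> L \<Longrightarrow> (\<And>I. I \<subseteq> S \<Longrightarrow> I \<noteq> {} \<Longrightarrow> Q (\<mu> - sum a I)) \<Longrightarrow> Q \<mu>"
    and \<mu>: "\<mu> \<in> L"
  shows "Q \<mu>"
proof -
  \<comment> \<open>The extra 1 keeps the minimum meaningful when \<open>S\<close> is empty.\<close>
  define m where "m = Min (insert 1 ((\<lambda>j. a j \<bullet> \<beta>) ` S))"
  have m: "m > 0" "\<And>j. j \<in> S \<Longrightarrow> m \<le> a j \<bullet> \<beta>" unfolding m_def using S by auto
  have sum_ge: "m \<le> sum a I \<bullet> \<beta>" if I: "I \<subseteq> S" "I \<noteq> {}" for I
  proof -
    obtain j where j: "j \<in> I" using I by blast
    have "m \<le> a j \<bullet> \<beta>" using j I m by blast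
    also have "\<dots> \<le> (\<Sum>j\<in>I. a j \<bullet> \<beta>)"
      by (rule member_le_sum[OF j]) (use I S in \<open>auto intro: finite_subset less_imp_le\<close>)
    finally show ?thesis by (simp add: inner_sum_left)
  qed
  have "Q \<mu>" if "\<mu> \<in> L" "\<mu> \<bullet> \<beta> < real k * m" for k \<mu>
    using that
  proof (induction k arbitrary: \<mu>)
    case 0
    then show ?case by (intro base) auto
  next
    case (Suc k)
    show ?case
    proof (rule step[OF Suc.prems(1)])
      fix I assume I: "I \<subseteq> S" "I \<noteq> {}"
      have "(\<mu> - sum a I) \<bullet> \<beta> < real k * m"
        using sum_ge[OF I] Suc.prems(2) by (simp add: inner_diff_left algebra_simps)
      then show "Q (\<mu> - sum a I)" using closed[OF Suc.prems(1) I(1)] by (intro Suc.IH)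
    qed
  qed
  moreover obtain k :: nat where "\<mu> \<bullet> \<beta> / m < real k" using reals_Archimedean2 by blast
  then have "\<mu> \<bullet> \<beta> < real k * m" using m(1) by (simp add: pos_divide_less_eq)
  ultimately show ?thesis using \<mu> by blast
qed

lemma chamber_quasipolynomial_periodic:
  assumes "finite J" "c \<in> conic_chambers J \<alpha>" "chamber_quasipolynomial L J \<alpha> c P"
  shows "periodic_polynomial_on L P"
proof (cases "c \<subseteq> family_cone J \<alpha>")
  case True
  then show ?thesis
    using assms(3) by (simp add: chamber_quasipolynomial_def partition_quasipolynomial_def)
next
  case False
  then have "\<And>\<mu>. \<mu> \<in> L \<Longrightarrow> P \<mu> = 0"
    using chamber_dichotomy[OF assms(1,2)] assms(3) by (simp add: chamber_quasipolynomial_def)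
  then show ?thesis using periodic_polynomial_on_cong periodic_polynomial_on_zero by metis
qed

text \<open>On a chamber missing the cone both sides vanish, since no partitions exist outside the
  cone; the two kinds of chamber can thus be treated alike.\<close>

lemma chamber_quasipolynomial_eq:
  assumes "finite J" "c \<in> conic_chambers J \<alpha>" "chamber_quasipolynomial L J \<alpha> c P"
    and x: "x \<in> c" "x \<in> L"
  shows "P x = of_nat (vector_partition J \<alpha> x)"
proof (cases "c \<subseteq> family_cone J \<alpha>")
  case True
  then show ?thesis
    using assms(3) x closure_subset[of c]
    by (auto simp: chamber_quasipolynomial_def partition_quasipolynomial_def)
next
  case False
  then have disj: "c \<inter> family_cone J \<alpha> = {}" using chamber_dichotomy[OF assms(1,2)] by blast
  then have "P x = 0" using assms(3) x by (simp add: chamber_quasipolynomial_def)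
  moreover have "vector_partition J \<alpha> x = 0"
    using vector_partition_nonzero_cone disj x by blast
  ultimately show ?thesis by simp
qed

lemma poly_on_progression_diffop:
  assumes "finite S" "\<And>I. I \<subseteq> S \<Longrightarrow> poly_on_progression (\<lambda>n. f (x - sum a I + of_nat n *\<^sub>R v))"
  shows "poly_on_progression (\<lambda>n. diffop S a f (x + of_nat n *\<^sub>R v))"
proof -
  have "(\<lambda>n. diffop S a f (x + of_nat n *\<^sub>R v))
      = (\<lambda>n. \<Sum>I\<in>Pow S. (-1) ^ card I * f (x - sum a I + of_nat n *\<^sub>R v))"
    unfolding diffop_def by (simp add: algebra_simps)
  moreover have "poly_on_progression (\<lambda>n. \<Sum>I\<in>Pow S. (-1) ^ card I * f (x - sum a I + of_nat n *\<^sub>R v))"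
    using assms by (intro poly_on_progression_sum poly_on_progression_cmult) auto
  ultimately show ?thesis by simp
qed

theorem theorem5p2:
  fixes L :: "'a::euclidean_space set"
    and J :: "'i set"
    and \<alpha> :: "'i \<Rightarrow> 'a"
    and \<beta> :: 'a
    and c_plus c_minus :: "'a set"
    and P_plus P_minus P_wall :: "'a \<Rightarrow> complex"
  assumes "full_lattice L"
    and "finite J"
    and "\<forall>j\<in>J. \<alpha> j \<in> L"
    and "\<exists>h. \<forall>j\<in>J. \<alpha> j \<bullet> h > 0"
    and "span (\<alpha> ` J) = UNIV"
    and "\<beta> \<noteq> 0"
    and "adjacent_chambers J \<alpha> \<beta> c_plus c_minus"
    and "c_plus \<subseteq> {\<xi>. \<xi> \<bullet> \<beta> > 0}"
    and "c_minus \<subseteq> {\<xi>. \<xi> \<bullet> \<beta> < 0}"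
    and "chamber_quasipolynomial L J \<alpha> c_plus P_plus"
    and "chamber_quasipolynomial L J \<alpha> c_minus P_minus"
    and "partition_quasipolynomial (L \<inter> hyperplane \<beta>) {j\<in>J. \<alpha> j \<in> hyperplane \<beta>} \<alpha>
           (wall \<beta> c_plus c_minus) P_wall"
  shows "periodic_polynomial_on L (\<lambda>\<mu>. P_plus \<mu> - P_minus \<mu>) \<and>
    (\<forall>\<mu>\<in>L. P_plus \<mu> - P_minus \<mu> \<in> \<int>) \<and>
    (\<forall>\<mu>\<in>L. finite {\<gamma> \<in> L \<inter> hyperplane \<beta>. wall_crossing_kernel J \<alpha> \<beta> (\<mu> - \<gamma>) \<noteq> 0} \<and>
       P_plus \<mu> - P_minus \<mu> =
         (\<Sum>\<^sub>\<infinity>\<gamma> \<in> L \<inter> hyperplane \<beta>. of_int (wall_crossing_kernel J \<alpha> \<beta> (\<mu> - \<gamma>)) * P_wall \<gamma>))"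
proof -
  note L = \<open>full_lattice L\<close> and J = \<open>finite J\<close>
  note L_add = full_lattice_add[OF L] and L_diff = full_lattice_diff[OF L] and L_sum = full_lattice_sum[OF L]
  have \<alpha>L: "\<alpha> j \<in> L" if "j \<in> J" for j using assms(3) that by blast
  obtain h where h: "\<And>j. j \<in> J \<Longrightarrow> \<alpha> j \<bullet> h > 0" using assms(4) by blast
  have ch: "c_plus \<in> conic_chambers J \<alpha>" "c_minus \<in> conic_chambers J \<alpha>"
    using assms(7) by (auto simp: adjacent_chambers_def)
  have per: "periodic_polynomial_on L P_plus" "periodic_polynomial_on L P_minus"
    using chamber_quasipolynomial_periodic[OF J] ch assms(10,11) by blast+
  have agree: "\<And>x. x \<in> c_plus \<Longrightarrow> x \<in> L \<Longrightarrow> P_plus x = of_nat (vector_partition J \<alpha> x)"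
    "\<And>x. x \<in> c_minus \<Longrightarrow> x \<in> L \<Longrightarrow> P_minus x = of_nat (vector_partition J \<alpha> x)"
    using chamber_quasipolynomial_eq[OF J] ch assms(10,11) by blast+
  obtain v where v: "v \<in> L" "v \<in> hyperplane \<beta>"
    and ev_plus: "\<And>x. x \<bullet> \<beta> > 0 \<Longrightarrow> \<forall>\<^sub>F n in sequentially. x + of_nat n *\<^sub>R v \<in> c_plus"
    and ev_minus: "\<And>x. x \<bullet> \<beta> < 0 \<Longrightarrow> \<forall>\<^sub>F n in sequentially. x + of_nat n *\<^sub>R v \<in> c_minus"
    and ev_wall: "\<And>x. x \<bullet> \<beta> = 0 \<Longrightarrow> \<forall>\<^sub>F n in sequentially. x + of_nat n *\<^sub>R v \<in> wall \<beta> c_plus c_minus"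
    using wall_direction[OF L J \<alpha>L assms(6-9)] by blast
  have v\<beta>: "v \<bullet> \<beta> = 0" using v(2) by (simp add: hyperplane_def)
  have line: "x + of_nat n *\<^sub>R w \<in> L" if "x \<in> L" "w \<in> L" for x w and n :: nat
    using L_add[OF that(1) full_lattice_scale[OF L that(2), of "int n"]] by simp

  \<comment> \<open>The signed family and the two halves of the kernel\<close>
  define S where "S = {j\<in>J. \<alpha> j \<bullet> \<beta> \<noteq> 0}"
  define Jp where "Jp = {j\<in>J. \<alpha> j \<bullet> \<beta> > 0}"
  define Jm where "Jm = {j\<in>J. \<alpha> j \<bullet> \<beta> < 0}"
  define J0 where "J0 = {j\<in>J. \<alpha> j \<in> hyperplane \<beta>}"
  define a where "a j = sgn (\<alpha> j \<bullet> \<beta>) *\<^sub>R \<alpha> j" for j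
  define \<Gamma> where "\<Gamma> = L \<inter> hyperplane \<beta>"
  define dp where "dp = (\<Sum>j\<in>Jp. \<alpha> j)"
  define dm where "dm = (\<Sum>j\<in>Jm. \<alpha> j)"
  define s :: complex where "s = (-1) ^ card Jm"
  define Np :: "'a \<Rightarrow> complex" where "Np x = of_nat (vector_partition S a x)" for x
  define NR :: "'a \<Rightarrow> complex" where "NR x = of_nat (vector_partition J \<alpha> x)" for x
  define N0 :: "'a \<Rightarrow> complex" where "N0 x = of_nat (vector_partition J0 \<alpha> x)" for x
  \<comment> \<open>The kernel is split so that \<open>Ep\<close> vanishes on the negative side and
    \<open>Em\<close> on the positive side.\<close>
  define Ep where "Ep x = s * Np (x + dm)" for x
  define Em where "Em x = (-1) ^ card Jp * Np (- dp - x)" for x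
  define D :: "'a \<Rightarrow> complex" where "D x = of_int (wall_crossing_kernel J \<alpha> \<beta> x)" for x
  have D_eq: "D x = Ep x - Em x" for x
  proof -
    have "- dp - x = - x - dp" by simp
    then have "Em x = (-1) ^ card Jp * Np (- x - dp)" by (simp only: Em_def)
    then show ?thesis
      by (simp add: D_def wall_crossing_kernel_def Let_def Ep_def s_def Np_def S_def Jp_def Jm_def
          a_def[abs_def] dp_def dm_def)
  qed

  have fin: "finite S" "finite Jp" "finite Jm" "finite J0" using J by (auto simp: S_def Jp_def Jm_def J0_def)
  have S_split: "S = Jp \<union> Jm" "Jp \<inter> Jm = {}" by (auto simp: S_def Jp_def Jm_def)
  have J_split: "S \<union> J0 = J" "S \<inter> J0 = {}" by (auto simp: S_def J0_def hyperplane_def)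
  have a_flip: "a j = (if j \<in> Jm then - \<alpha> j else \<alpha> j)" if "j \<in> S" for j
    using that by (auto simp: a_def S_def Jm_def sgn_real_def)
  have a_pos: "a j \<bullet> \<beta> > 0" if "j \<in> S" for j
    using that by (auto simp: a_def S_def sgn_real_def)
  have aL: "a j \<in> L" if "j \<in> S" for j
    using a_flip[OF that] \<alpha>L[of j] that full_lattice_scale[OF L \<alpha>L, of j "-1"] by (auto simp: S_def)
  have aI: "\<mu> - sum a I \<in> L" if "\<mu> \<in> L" "I \<subseteq> S" for \<mu> I
    using that aL by (intro L_diff L_sum) auto
  have aI_nonneg: "sum a I \<bullet> \<beta> \<ge> 0" if "I \<subseteq> S" for I
    unfolding inner_sum_left using that a_pos by (intro sum_nonneg) (auto intro: less_imp_le)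
  have dp_ge: "dp \<bullet> \<beta> \<ge> 0" unfolding dp_def inner_sum_left by (intro sum_nonneg) (auto simp: Jp_def)
  have dm_le: "dm \<bullet> \<beta> \<le> 0" unfolding dm_def inner_sum_left by (intro sum_nonpos) (auto simp: Jm_def)
  have dmL: "dm \<in> L" unfolding dm_def using \<alpha>L by (intro L_sum) (auto simp: Jm_def)
  \<comment> \<open>This identity later places the delta functions coming from both halves of the
    kernel at the same point.\<close>
  have sum_aS: "sum a S = dp - dm"
  proof -
    have "sum a S = sum a Jp + sum a Jm" unfolding S_split(1) using fin S_split(2) by (intro sum.union_disjoint)
    also have "sum a Jp = dp" unfolding dp_def by (rule sum.cong) (use a_flip S_split in auto)
    also have "sum a Jm = - dm" unfolding dm_def sum_negf[symmetric]
      by (rule sum.cong) (use a_flip S_split in auto)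
    finally show ?thesis by simp
  qed
  \<comment> \<open>A family inside the hyperplane could not span. The vector \<open>a j0\<close>
    later serves as a direction that leaves every strip around the hyperplane.\<close>
  obtain j0 where j0: "j0 \<in> S"
  proof -
    have "S \<noteq> {}"
    proof
      assume "S = {}"
      then have "\<alpha> ` J \<subseteq> hyperplane \<beta>" by (auto simp: S_def hyperplane_def)
      then have "span (\<alpha> ` J) \<subseteq> hyperplane \<beta>" by (rule span_minimal[OF _ subspace_hyperplane])
      then have "\<beta> \<in> hyperplane \<beta>" using assms(5) by blast
      with \<open>\<beta> \<noteq> 0\<close> show False by (simp add: hyperplane_def)
    qed
    with that show ?thesis by blast
  qed

  \<comment> \<open>The operator on partition functions and on the kernel\<close>
  let ?T = "diffop S a"
  have T_flip: "?T f \<mu> = s * diffop S \<alpha> f (\<mu> + dm)" for f \<mu>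
  proof -
    have "?T f \<mu> = diffop S (\<lambda>j. if j \<in> Jm then - \<alpha> j else \<alpha> j) f \<mu>"
      using a_flip by (intro diffop_cong) auto
    also have "\<dots> = (-1) ^ card (S \<inter> Jm) * diffop S \<alpha> f (\<mu> + sum \<alpha> (S \<inter> Jm))"
      by (rule diffop_flip[OF fin(1)])
    also have "S \<inter> Jm = Jm" using S_split by blast
    finally show ?thesis by (simp add: s_def dm_def)
  qed
  \<comment> \<open>The differences over \<open>S\<close> strip off all generators outside the
    hyperplane and leave those indexed by \<open>J0\<close>.\<close>
  have T_NR: "?T NR \<mu> = s * N0 (\<mu> + dm)" for \<mu>
    unfolding T_flip NR_def[abs_def] N0_def
    using diffop_vector_partition[of S J0 \<alpha> h "\<mu> + dm"] fin J_split h by auto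
  have T_Np: "?T Np \<mu> = (if \<mu> = 0 then 1 else 0)" for \<mu>
    unfolding Np_def[abs_def]
    using diffop_vector_partition[of S "{}" a \<beta> \<mu>] fin a_pos by (simp add: vector_partition_empty)
  have T_Ep: "?T Ep \<mu> = s * (if \<mu> + dm = 0 then 1 else 0)" for \<mu>
    unfolding Ep_def[abs_def] diffop_cmult diffop_translate T_Np ..
  \<comment> \<open>Reflection contributes the sign \<open>(-1) ^ card S\<close>; since
    \<open>card S = card Jp + card Jm\<close>, the total sign is \<open>s\<close>, and
    \<open>sum_aS\<close> puts the delta where that of \<open>Ep\<close> is.\<close>
  have T_Em: "?T Em \<mu> = s * (if \<mu> + dm = 0 then 1 else 0)" for \<mu>
  proof -
    have "?T Em \<mu> = (-1) ^ card Jp * ((-1) ^ card S * (if - dp - \<mu> + sum a S = 0 then 1 else 0))"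
      unfolding Em_def[abs_def] diffop_cmult diffop_reflect[OF fin(1)] T_Np ..
    also have "card S = card Jp + card Jm"
      unfolding S_split(1) using fin S_split(2) by (intro card_Un_disjoint)
    also have "- dp - \<mu> + sum a S = 0 \<longleftrightarrow> \<mu> + dm = 0"
      unfolding sum_aS by (auto simp: algebra_simps add_eq_0_iff)
    finally show ?thesis by (simp add: s_def power_add flip: power_mult_distrib mult.assoc)
  qed

  \<comment> \<open>Supports of the two halves\<close>
  have N0_zero: "N0 x = 0" if "x \<bullet> \<beta> \<noteq> 0" for x
    using vector_partition_nonzero_hyperplane[of J0 \<alpha> \<beta> x] that by (auto simp: N0_def J0_def)
  have Np_zero: "Np x = 0" if "x \<bullet> \<beta> < 0" for x
    using vector_partition_nonzero_inner[of S a \<beta> x] a_pos that by (force simp: Np_def)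
  have Ep_zero: "Ep x = 0" if "x \<bullet> \<beta> < 0" for x
    unfolding Ep_def using that dm_le by (subst Np_zero) (auto simp: inner_add_left)
  have Em_zero: "Em x = 0" if "x \<bullet> \<beta> > 0" for x
    unfolding Em_def using that dp_ge by (subst Np_zero) (auto simp: inner_diff_left)
  have \<Gamma>: "\<gamma> \<in> L" "\<gamma> \<bullet> \<beta> = 0" if "\<gamma> \<in> \<Gamma>" for \<gamma> using that by (auto simp: \<Gamma>_def hyperplane_def)
  have \<Gamma>_add: "x + y \<in> \<Gamma>" if "x \<in> \<Gamma>" "y \<in> \<Gamma>" for x y
    using that L_add by (auto simp: \<Gamma>_def hyperplane_def inner_add_left)
  have v\<Gamma>: "v \<in> \<Gamma>" using v by (simp add: \<Gamma>_def)
  have fin_Ep: "finite {\<gamma>\<in>\<Gamma>. Ep (x - \<gamma>) \<noteq> 0}" for x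
    by (rule finite_subset[OF _ finite_partition_support[of S a \<beta> \<Gamma> "-1" "x + dm"]])
       (use fin a_pos in \<open>auto simp: Ep_def Np_def \<Gamma>_def algebra_simps\<close>)
  have fin_Em: "finite {\<gamma>\<in>\<Gamma>. Em (x - \<gamma>) \<noteq> 0}" for x
    by (rule finite_subset[OF _ finite_partition_support[of S a \<beta> \<Gamma> 1 "- dp - x"]])
       (use fin a_pos in \<open>auto simp: Em_def Np_def \<Gamma>_def algebra_simps\<close>)
  have fin_D: "finite {\<gamma>\<in>\<Gamma>. D (x - \<gamma>) \<noteq> 0}" for x
    by (rule finite_subset[OF _ finite_UnI[OF fin_Ep[of x] fin_Em[of x]]]) (auto simp: D_eq)

  \<comment> \<open>Convolution with the wall quasi-polynomial\<close>
  define conv where "conv f x = (\<Sum>\<^sub>\<infinity>\<gamma>\<in>\<Gamma>. f (x - \<gamma>) * P_wall \<gamma>)" for f x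
  have T_conv: "?T (conv f) \<mu> = conv (?T f) \<mu>" if "\<And>x. finite {\<gamma>\<in>\<Gamma>. f (x - \<gamma>) \<noteq> 0}" for f \<mu>
    unfolding conv_def[abs_def] by (rule diffop_infsum_convolution[OF fin(1) that])
  \<comment> \<open>The delta selects \<gamma> = \<mu> + dm if this lies in \<Gamma> at all; summing
    over the intersection covers both cases.\<close>
  have T_conv_Ep: "?T (conv Ep) \<mu> = (if \<mu> + dm \<in> \<Gamma> then s * P_wall (\<mu> + dm) else 0)" for \<mu>
  proof -
    have "?T (conv Ep) \<mu> = (\<Sum>\<^sub>\<infinity>\<gamma>\<in>\<Gamma>. s * (if \<mu> - \<gamma> + dm = 0 then 1 else 0) * P_wall \<gamma>)"
      unfolding T_conv[OF fin_Ep] conv_def T_Ep ..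
    also have "\<dots> = (\<Sum>\<gamma>\<in>\<Gamma> \<inter> {\<mu> + dm}. s * (if \<mu> - \<gamma> + dm = 0 then 1 else 0) * P_wall \<gamma>)"
      by (rule infsum_finite_support) (auto simp: algebra_simps)
    finally show ?thesis by auto
  qed
  \<comment> \<open>The deltas of the two halves coincide, so the operator annihilates
    \<open>D\<close> itself.\<close>
  have T_conv_D: "?T (conv D) \<mu> = 0" for \<mu>
  proof -
    have "?T D x = 0" for x unfolding D_eq[abs_def] diffop_diff T_Ep T_Em by simp
    then show ?thesis unfolding T_conv[OF fin_D] conv_def by simp
  qed
  have conv_Ep_zero: "conv Ep x = 0" if "x \<bullet> \<beta> < 0" for x
    unfolding conv_def using that \<Gamma> by (intro infsum_0) (simp add: Ep_zero inner_diff_left)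
  have conv_D_Ep: "conv D x = conv Ep x" if "x \<bullet> \<beta> > 0" for x
    unfolding conv_def using that \<Gamma> by (intro infsum_cong) (simp add: D_eq Em_zero inner_diff_left)

  \<comment> \<open>Deep inside a chamber the operator turns the partition function into that of \<open>R \<inter> \<Delta>\<close>, which
    vanishes off \<open>\<Delta>\<close>; a quasi-polynomial that eventually vanishes along every line vanishes.\<close>
  have T_P_zero: "?T P x = 0"
    if P: "periodic_polynomial_on L P" and R: "\<And>x. R x \<Longrightarrow> \<forall>\<^sub>F n in sequentially. x + of_nat n *\<^sub>R v \<in> c"
      and eq: "\<And>x. x \<in> c \<Longrightarrow> x \<in> L \<Longrightarrow> P x = of_nat (vector_partition J \<alpha> x)"
      and H: "\<And>x. H x \<Longrightarrow> (\<forall>I\<subseteq>S. R (x - sum a I)) \<and> (x + dm) \<bullet> \<beta> \<noteq> 0"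
      and w: "w \<in> L" "\<And>x. \<forall>\<^sub>F n in sequentially. H (x + of_nat n *\<^sub>R w)" and x: "x \<in> L"
    for P x R H c w
  proof -
    have prog: "poly_on_progression (\<lambda>n. ?T P (y + of_nat n *\<^sub>R u))" if "y \<in> L" "u \<in> L" for y u
      by (intro poly_on_progression_diffop[OF fin(1)] periodic_polynomial_along_line[OF P L_add] aI that)
    \<comment> \<open>On \<open>H\<close> every shift that the operator reads runs along
      \<open>v\<close> into the chamber, while the point where \<open>N0\<close> is evaluated stays
      off the hyperplane.\<close>
    have zero: "?T P y = 0" if y: "y \<in> L" "H y" for y
    proof -
      have "\<forall>\<^sub>F n in sequentially. \<forall>I\<in>Pow S. y - sum a I + of_nat n *\<^sub>R v \<in> c"
        using H[OF y(2)] R fin(1) by (intro eventually_ball_finite) auto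
      then have "\<forall>\<^sub>F n in sequentially. ?T P (y + of_nat n *\<^sub>R v) = 0"
      proof eventually_elim
        case (elim n)
        have "?T P (y + of_nat n *\<^sub>R v) = ?T NR (y + of_nat n *\<^sub>R v)"
        proof (rule diffop_cong[OF refl])
          fix I assume I: "I \<subseteq> S"
          have e: "y + of_nat n *\<^sub>R v - sum a I = y - sum a I + of_nat n *\<^sub>R v" by simp
          show "P (y + of_nat n *\<^sub>R v - sum a I) = NR (y + of_nat n *\<^sub>R v - sum a I)"
            unfolding e NR_def using elim I by (intro eq line aI y v) auto
        qed
        also have "\<dots> = 0"
          unfolding T_NR using H[OF y(2)] by (subst N0_zero) (auto simp: inner_add_left v\<beta>)
        finally show ?case .
      qed
      from poly_on_progression_eventually_zero[OF prog[OF y(1) v(1)] this] show ?thesis by simp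
    qed
    \<comment> \<open>The direction \<open>w\<close> carries any lattice point into
      \<open>H\<close>, and polynomiality along \<open>w\<close> brings the vanishing back to
      \<open>x\<close>.\<close>
    have "\<forall>\<^sub>F n in sequentially. ?T P (x + of_nat n *\<^sub>R w) = 0"
      using w(2)[of x] by eventually_elim (intro zero line x w(1))
    from poly_on_progression_eventually_zero[OF prog[OF x w(1)] this] show ?thesis by simp
  qed
  have T_minus: "?T P_minus x = 0" if "x \<in> L" for x
  proof (rule T_P_zero[OF per(2) ev_minus agree(2) _ _ _ that])
    \<comment> \<open>Subtracting sums only lowers the \<beta>-value, so here \<open>H\<close> can
      be the whole open negative half-space.\<close>
    show "(\<forall>I\<subseteq>S. (y - sum a I) \<bullet> \<beta> < 0) \<and> (y + dm) \<bullet> \<beta> \<noteq> 0" if y: "y \<bullet> \<beta> < 0" for y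
    proof (intro conjI allI impI)
      show "(y - sum a I) \<bullet> \<beta> < 0" if "I \<subseteq> S" for I
        using aI_nonneg[OF that] y by (simp add: inner_diff_left)
      show "(y + dm) \<bullet> \<beta> \<noteq> 0" using dm_le y by (simp add: inner_add_left)
    qed
    show "- a j0 \<in> L" using L_diff[OF full_lattice_zero[OF L] aL[OF j0]] by simp
    show "\<forall>\<^sub>F n in sequentially. (y + of_nat n *\<^sub>R - a j0) \<bullet> \<beta> < 0" for y
      using eventually_gt_linear[OF a_pos[OF j0], of 0 "- (y \<bullet> \<beta>)"]
      by eventually_elim (simp add: inner_diff_left)
  qed
  have T_plus: "?T P_plus x = 0" if "x \<in> L" for x
  proof (rule T_P_zero[OF per(1) ev_plus agree(1) _ _ _ that])
    \<comment> \<open>The threshold \<open>sum a S \<bullet> \<beta>\<close> is the largest possible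
      drop, so all shifted points stay positive; by \<open>sum_aS\<close> the \<beta>-value of
      \<open>y + dm\<close> is then positive too.\<close>
    show "(\<forall>I\<subseteq>S. (y - sum a I) \<bullet> \<beta> > 0) \<and> (y + dm) \<bullet> \<beta> \<noteq> 0" if y: "y \<bullet> \<beta> > sum a S \<bullet> \<beta>" for y
    proof (intro conjI allI impI)
      fix I assume I: "I \<subseteq> S"
      have "sum a S = sum a (S - I) + sum a I" using fin(1) I by (simp add: sum.subset_diff)
      then show "(y - sum a I) \<bullet> \<beta> > 0"
        using y aI_nonneg[of "S - I"] by (simp add: inner_diff_left inner_add_left)
    next
      show "(y + dm) \<bullet> \<beta> \<noteq> 0" using y dp_ge by (simp add: sum_aS inner_diff_left inner_add_left)
    qed
    show "a j0 \<in> L" by (rule aL[OF j0])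
    show "\<forall>\<^sub>F n in sequentially. (y + of_nat n *\<^sub>R a j0) \<bullet> \<beta> > sum a S \<bullet> \<beta>" for y
      using eventually_gt_linear[OF a_pos[OF j0], of "sum a S \<bullet> \<beta>" "y \<bullet> \<beta>"]
      by eventually_elim (simp add: inner_add_left)
  qed

  \<comment> \<open>Crossing the wall along a ray\<close>
  have wall_per: "periodic_polynomial_on \<Gamma> P_wall"
    and wall_eq: "\<And>x. x \<in> wall \<beta> c_plus c_minus \<Longrightarrow> x \<in> \<Gamma> \<Longrightarrow> P_wall x = N0 x"
    using assms(12) closure_subset
    by (auto simp: partition_quasipolynomial_def \<Gamma>_def N0_def J0_def)
  \<comment> \<open>\<open>Z\<close> vanishes near the wall on the negative side. Since the operator annihilates it near the wall
    and only looks in the direction of decreasing \<open>\<beta>\<close>, the vanishing spreads to the positive side,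
    where \<open>Z\<close> is the defect \<open>G\<close> of the claimed formula.\<close>
  define Z where "Z x = NR x - P_minus x - conv Ep x" for x
  have T_Z: "?T Z x = s * N0 (x + dm) - (if x + dm \<in> \<Gamma> then s * P_wall (x + dm) else 0)" if "x \<in> L" for x
    unfolding Z_def[abs_def] diffop_diff T_NR T_conv_Ep using T_minus[OF that] by simp
  \<comment> \<open>The induction concerns rays in direction \<open>v\<close> rather than points,
    since partition functions and quasi-polynomials are known to agree only far out.\<close>
  have Z_zero: "\<forall>\<^sub>F n in sequentially. Z (\<mu> + of_nat n *\<^sub>R v) = 0" if "\<mu> \<in> L" for \<mu>
  proof (rule half_space_induct[where S = S and a = a and \<beta> = \<beta> and L = L, OF fin(1) a_pos aI _ _ that])
    fix \<mu> assume \<mu>: "\<mu> \<in> L" "\<mu> \<bullet> \<beta> < 0"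
    show "\<forall>\<^sub>F n in sequentially. Z (\<mu> + of_nat n *\<^sub>R v) = 0"
      using ev_minus[OF \<mu>(2)]
    proof eventually_elim
      case (elim n)
      then show ?case
        using agree(2)[OF elim line[OF \<mu>(1) v(1)]] conv_Ep_zero[of "\<mu> + of_nat n *\<^sub>R v"] \<mu>(2)
        by (simp add: Z_def NR_def inner_add_left v\<beta>)
    qed
  next
    fix \<mu> assume \<mu>: "\<mu> \<in> L"
      and IH: "\<And>I. I \<subseteq> S \<Longrightarrow> I \<noteq> {} \<Longrightarrow> \<forall>\<^sub>F n in sequentially. Z (\<mu> - sum a I + of_nat n *\<^sub>R v) = 0"
    have "\<forall>\<^sub>F n in sequentially. ?T Z (\<mu> + of_nat n *\<^sub>R v) = 0"
    \<comment> \<open>If \<open>\<mu> + dm\<close> is on the hyperplane, \<open>P_wall\<close> and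
      \<open>N0\<close> agree far out in the wall and the two terms of \<open>T_Z\<close> cancel;
      otherwise both terms vanish.\<close>
    proof (cases "(\<mu> + dm) \<bullet> \<beta> = 0")
      case True
      from ev_wall[OF True] show ?thesis
      proof eventually_elim
        case (elim n)
        have e: "\<mu> + of_nat n *\<^sub>R v + dm = \<mu> + dm + of_nat n *\<^sub>R v" by simp
        have "\<mu> + dm + of_nat n *\<^sub>R v \<in> \<Gamma>"
          using line[OF L_add[OF \<mu> dmL] v(1)] True by (simp add: \<Gamma>_def hyperplane_def inner_add_left v\<beta>)
        then show ?case unfolding T_Z[OF line[OF \<mu> v(1)]] e using wall_eq[OF elim] by simp
      qed
    next
      case False
      then have "N0 (\<mu> + of_nat n *\<^sub>R v + dm) = 0" "\<mu> + of_nat n *\<^sub>R v + dm \<notin> \<Gamma>" for n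
        by (auto intro!: N0_zero simp: inner_add_left v\<beta> dest!: \<Gamma>(2))
      then show ?thesis by (simp add: T_Z line \<mu> v)
    qed
    moreover have "\<forall>\<^sub>F n in sequentially. \<forall>I\<in>Pow S - {{}}. Z (\<mu> - sum a I + of_nat n *\<^sub>R v) = 0"
      using IH fin(1) by (intro eventually_ball_finite) auto
    ultimately show "\<forall>\<^sub>F n in sequentially. Z (\<mu> + of_nat n *\<^sub>R v) = 0"
    proof eventually_elim
      case (elim n)
      have "(\<Sum>I\<in>Pow S - {{}}. (-1) ^ card I * Z (\<mu> + of_nat n *\<^sub>R v - sum a I)) = 0"
      proof (intro sum.neutral ballI)
        fix I assume I: "I \<in> Pow S - {{}}"
        have e: "\<mu> + of_nat n *\<^sub>R v - sum a I = \<mu> - sum a I + of_nat n *\<^sub>R v" by simp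
        show "(-1) ^ card I * Z (\<mu> + of_nat n *\<^sub>R v - sum a I) = 0" unfolding e using elim(2) I by simp
      qed
      with elim(1) show ?case unfolding diffop_first_term[OF fin(1)] by simp
    qed
  qed

  \<comment> \<open>Vanishing of the defect on the whole lattice\<close>
  define G where "G x = P_plus x - P_minus x - conv D x" for x
  have G_pos: "G \<mu> = 0" if \<mu>: "\<mu> \<in> L" "\<mu> \<bullet> \<beta> > 0" for \<mu>
  proof -
    let ?F = "{\<gamma>\<in>\<Gamma>. D (\<mu> - \<gamma>) \<noteq> 0}"
    \<comment> \<open>Translating \<Gamma> by n v moves the dependence on n from \<open>D\<close> to
      \<open>P_wall\<close>; the sum then runs over a finite set independent of n and is polynomial
      along a progression term by term.\<close>
    have conv_line: "conv D (\<mu> + of_nat n *\<^sub>R v) = (\<Sum>\<gamma>\<in>?F. D (\<mu> - \<gamma>) * P_wall (\<gamma> + of_nat n *\<^sub>R v))" for n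
    proof -
      have nv: "of_nat n *\<^sub>R v \<in> \<Gamma>" "- (of_nat n *\<^sub>R v) \<in> \<Gamma>"
        using full_lattice_scale[OF L v(1), of "int n"] full_lattice_scale[OF L v(1), of "- int n"] v(2)
        by (simp_all add: \<Gamma>_def hyperplane_def)
      have "bij_betw (\<lambda>\<gamma>. \<gamma> + of_nat n *\<^sub>R v) \<Gamma> \<Gamma>"
        by (rule bij_betwI[of _ _ _ "\<lambda>\<gamma>. \<gamma> + - (of_nat n *\<^sub>R v)"]) (use \<Gamma>_add[OF _ nv(1)] \<Gamma>_add[OF _ nv(2)] in auto)
      from infsum_reindex_bij_betw[OF this, of "\<lambda>\<gamma>. D (\<mu> + of_nat n *\<^sub>R v - \<gamma>) * P_wall \<gamma>", symmetric]
      have "conv D (\<mu> + of_nat n *\<^sub>R v) = (\<Sum>\<^sub>\<infinity>\<gamma>\<in>\<Gamma>. D (\<mu> - \<gamma>) * P_wall (\<gamma> + of_nat n *\<^sub>R v))"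
        by (simp add: conv_def)
      also have "\<dots> = (\<Sum>\<gamma>\<in>?F. D (\<mu> - \<gamma>) * P_wall (\<gamma> + of_nat n *\<^sub>R v))"
        by (rule infsum_finite_support[OF fin_D]) auto
      finally show ?thesis .
    qed
    have "poly_on_progression (\<lambda>n. G (\<mu> + of_nat n *\<^sub>R v))"
      unfolding G_def conv_line
      by (intro poly_on_progression_diff poly_on_progression_sum[OF fin_D] poly_on_progression_cmult
          periodic_polynomial_along_line[OF per(1) L_add] periodic_polynomial_along_line[OF per(2) L_add]
          periodic_polynomial_along_line[OF wall_per \<Gamma>_add] \<mu> v v\<Gamma>) auto
    \<comment> \<open>Far out on the positive side \<open>P_plus\<close> equals \<open>NR\<close>
      and \<open>conv D\<close> equals \<open>conv Ep\<close>, so \<open>G\<close> coincides with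
      \<open>Z\<close>.\<close>
    moreover have "\<forall>\<^sub>F n in sequentially. G (\<mu> + of_nat n *\<^sub>R v) = 0"
      using Z_zero[OF \<mu>(1)] ev_plus[OF \<mu>(2)]
    proof eventually_elim
      case (elim n)
      then show ?case
        using agree(1)[OF elim(2) line[OF \<mu>(1) v(1)]] conv_D_Ep[of "\<mu> + of_nat n *\<^sub>R v"] \<mu>(2)
        by (simp add: Z_def G_def NR_def inner_add_left v\<beta>)
    qed
    ultimately show ?thesis using poly_on_progression_eventually_zero by force
  qed
  have neg: "- x \<in> L" if "x \<in> L" for x using L_diff[OF full_lattice_zero[OF L] that] by simp
  have T_G: "?T G x = 0" if "x \<in> L" for x
    unfolding G_def[abs_def] diffop_diff T_conv_D using T_plus[OF that] T_minus[OF that] by simp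
  \<comment> \<open>The operator annihilates \<open>G\<close> on all of \<open>L\<close>, so vanishing on the positive side spreads back.\<close>
  have G_neg: "G (0 - \<mu>) = 0" if "\<mu> \<in> L" for \<mu>
  proof (rule half_space_induct[where S = S and a = a and \<beta> = \<beta> and L = L, OF fin(1) a_pos aI _ _ that])
    \<comment> \<open>Because the induction variable is reflected, its base case is the positive
      side for \<open>G\<close>.\<close>
    show "G (0 - \<mu>) = 0" if "\<mu> \<in> L" "\<mu> \<bullet> \<beta> < 0" for \<mu>
      using that by (intro G_pos) (auto simp: neg)
  next
    fix \<mu> assume \<mu>: "\<mu> \<in> L" and IH: "\<And>I. I \<subseteq> S \<Longrightarrow> I \<noteq> {} \<Longrightarrow> G (0 - (\<mu> - sum a I)) = 0"
    \<comment> \<open>Up to sign, the operator applied to the reflected function at \<mu> is the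
      operator applied to \<open>G\<close> at this lattice point.\<close>
    have "0 - \<mu> + sum a S \<in> L" using aL neg[OF \<mu>] L_add[OF neg[OF \<mu>] L_sum[of S a]] by simp
    then have "?T (\<lambda>x. G (0 - x)) \<mu> = 0" unfolding diffop_reflect[OF fin(1)] by (simp add: T_G)
    moreover have "(\<Sum>I\<in>Pow S - {{}}. (-1) ^ card I * G (0 - (\<mu> - sum a I))) = 0"
      by (intro sum.neutral ballI) (use IH in auto)
    ultimately show "G (0 - \<mu>) = 0" unfolding diffop_first_term[OF fin(1)] by simp
  qed
  have main: "P_plus \<mu> - P_minus \<mu> = conv D \<mu>" if "\<mu> \<in> L" for \<mu>
    using G_neg[OF neg[OF that]] by (simp add: G_def)

  \<comment> \<open>Integrality and finiteness of the support\<close>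
  have wall_int: "P_wall \<gamma> \<in> \<int>" if "\<gamma> \<in> \<Gamma>" for \<gamma>
  proof -
    \<comment> \<open>Far out in the wall the values are counts; polynomiality along
      \<open>v\<close> carries integrality back to \<gamma>.\<close>
    have "\<forall>\<^sub>F n in sequentially. P_wall (\<gamma> + of_nat n *\<^sub>R v) \<in> \<int>"
      using ev_wall[OF \<Gamma>(2)[OF that]]
    proof eventually_elim
      case (elim n)
      have "\<gamma> + of_nat n *\<^sub>R v \<in> \<Gamma>"
        using line[OF \<Gamma>(1)[OF that] v(1), of n] \<Gamma>(2)[OF that] by (simp add: \<Gamma>_def hyperplane_def inner_add_left v\<beta>)
      then show ?case using wall_eq[OF elim] by (simp add: N0_def)
    qed
    from poly_on_progression_eventually_Ints[OF periodic_polynomial_along_line[OF wall_per \<Gamma>_add that v\<Gamma>] this]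
    show ?thesis by simp
  qed
  have "conv D \<mu> \<in> \<int>" for \<mu>
  proof -
    have "conv D \<mu> = (\<Sum>\<gamma>\<in>{\<gamma>\<in>\<Gamma>. D (\<mu> - \<gamma>) \<noteq> 0}. D (\<mu> - \<gamma>) * P_wall \<gamma>)"
      unfolding conv_def by (rule infsum_finite_support[OF fin_D]) auto
    also have "\<dots> \<in> \<int>" by (intro Ints_sum Ints_mult) (auto simp: D_def wall_int)
    finally show ?thesis .
  qed
  moreover have "finite {\<gamma> \<in> \<Gamma>. wall_crossing_kernel J \<alpha> \<beta> (\<mu> - \<gamma>) \<noteq> 0}" for \<mu>
    using fin_D[of \<mu>] by (simp add: D_def)
  ultimately show ?thesis
    using main periodic_polynomial_on_diff[OF per]
    unfolding conv_def D_def \<Gamma>_def by simp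
qed

end
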